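(* Let $w$ be a perfectly clustering AR word on the alphabet $\{a,b,c\}$ which is not in the range of any of the six AR morphisms $\tau_x$ and $\sigma_x$, $x\in\{a,b,c\}$. Then, up to a permutation of the letters $a,b,c$, there exists a word $v$ on the alphabet $\{a,c\}$ containing both $a$ and $c$ such that $w$ is obtained from $\tau_v(b)$ by inserting a single $b$ between each pair of consecutive (adjacent) occurrences of $a$, or between each pair of consecutive (adjacent) occurrences of $c$, in $\tau_v(b)$ (where at most one of $aa$ and $cc$ can occur in $\tau_v(b)$), plus a $b$ at the very beginning; equivalently, the conjugate $w'=b^{-1}wb$ of $w$ is obtained from $\tau_v(b)$ by the same insertions plus a $b$ at the very end. Furthermore, $w$ is a palindrome beginning and ending in $b$, containing both $a$ and $c$ but neither $aa$ nor $cc$, $w$ is primitive, and any order for which $w$ is perfectly clustering has $b$ as the middle letter. Conversely, any word $w$ built in this way from a word $v$ on $\{a,c\}$ containing both $a$ and $c$ is an AR word which is perfectly clustering for the order $a<b<c$ and is not in the range of any of the six AR morphisms.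
   Context: AR morphisms: for $x,y\in\{a,b,c\}$, $\sigma_x$ is the morphism (for concatenation) with $\sigma_x(x)=x$ and $\sigma_x(y)=yx$ for $y\ne x$; $\tau_x$ is the morphism with $\tau_x(x)=x$ and $\tau_x(y)=xy$ for $y\neq x$. For a word $v=v_1\cdots v_n$, $\tau_v=\tau_{v_1}\circ\cdots\circ\tau_{v_n}$. The range of a morphism is its image on the set of words over $\{a,b,c\}$. If $w=bu$, then $b^{-1}wb=ub$. A word is primitive if it is not a power of another word. AR (Arnoux-Rauzy) languages. Given an infinite sequence of rules $(x_k)_{k\ge0}$, $x_k\in\{a,b,c\}$, in which each of $a,b,c$ occurs infinitely often, define words by $A_0=a$, $B_0=b$, $C_0=c$ and: by rule $(a)$ at stage $k$ (i.e. $x_k=a$), $A_{k+1}=A_k$, $B_{k+1}=B_kA_k$, $C_{k+1}=C_kA_k$; by rule $(b)$, $A_{k+1}=A_kB_k$, $B_{k+1}=B_k$, $C_{k+1}=C_kB_k$; by rule $(c)$, $A_{k+1}=A_kC_k$, $B_{k+1}=B_kC_k$, $C_{k+1}=C_k$. The AR language $\Lambda$ is the set of all factors of the words $A_k,B_k,C_k$, $k\ge0$. An AR word is an element of some AR language. Clustering. For a total order on the alphabet, written $a_1<\dots<a_r$, the Burrows-Wheeler transform $B(w)$ of a word $w=w_1\cdots w_n$ is obtained by listing its $n$ cyclic conjugates $w_i\cdots w_nw_1\cdots w_{i-1}$ (with multiplicity) in nondecreasing lexicographical order and reading the sequence of their last letters. The word $w$ is perfectly clustering for this order if $B(w)=(\pi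 a_1)^{n_{\pi a_1}}\cdots(\pi a_r)^{n_{\pi a_r}}$ for the symmetric permutation $\pi a_i=a_{r+1-i}$, where $n_a\ge0$ is the number of occurrences of $a$ in $w$. A word is perfectly clustering if it is so for some order on $\{a,b,c\}$. *)

theory Defs
  imports "HOL-Library.List_Lexorder" "HOL-Library.Sublist"
begin

datatype letter = La | Lb | Lc

type_synonym word = "letter list"

text \<open>Factors of a word are its contiguous subwords, i.e. the library predicate \<open>sublist\<close>.\<close>

definition sigma :: "letter \<Rightarrow> word \<Rightarrow> word" where
  "sigma x w = concat (map (\<lambda>y. if y = x then [x] else [y, x]) w)"

definition tau :: "letter \<Rightarrow> word \<Rightarrow> word" where
  "tau x w = concat (map (\<lambda>y. if y = x then [x] else [x, y]) w)"

definition tau_word :: "word \<Rightarrow> word \<Rightarrow> word" where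
  "tau_word v = foldr (\<lambda>x f. tau x \<circ> f) v id"

text \<open>\<open>ar_block x k La\<close>, \<open>ar_block x k Lb\<close>, \<open>ar_block x k Lc\<close> are the words
  $A_k$, $B_k$, $C_k$ produced by the sequence of rules \<open>x\<close>.\<close>

fun ar_block :: "(nat \<Rightarrow> letter) \<Rightarrow> nat \<Rightarrow> letter \<Rightarrow> word" where
  "ar_block x 0 y = [y]"
| "ar_block x (Suc k) y =
     (if y = x k then ar_block x k y else ar_block x k y @ ar_block x k (x k))"

definition ar_rules :: "(nat \<Rightarrow> letter) \<Rightarrow> bool" where
  "ar_rules x \<longleftrightarrow> (\<forall>y. infinite {k. x k = y})"

definition ar_language :: "(nat \<Rightarrow> letter) \<Rightarrow> word set" where
  "ar_language x = {u. \<exists>k y. sublist u (ar_block x k y)}"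

definition ar_word :: "word \<Rightarrow> bool" where
  "ar_word w \<longleftrightarrow> (\<exists>x. ar_rules x \<and> w \<in> ar_language x)"

text \<open>A total order $a_1 < \dots < a_r$ on the alphabet is given by the list
  $[a_1, \dots, a_r]$ enumerating the alphabet increasingly and without repetition.\<close>

definition alphabet_order :: "letter list \<Rightarrow> bool" where
  "alphabet_order ord \<longleftrightarrow> distinct ord \<and> set ord = UNIV"

definition rank :: "letter list \<Rightarrow> letter \<Rightarrow> nat" where
  "rank ord x = length (takeWhile (\<lambda>y. y \<noteq> x) ord)"

text \<open>The list of all conjugates, with multiplicity: one for each starting position.\<close>

definition conjugates :: "word \<Rightarrow> word list" where
  "conjugates w = map (\<lambda>i. rotate i w) [0..<length w]"

text \<open>Words are compared lexicographically for \<open>ord\<close> by comparing their lists of ranks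
  in the lexicographic order on \<^typ>\<open>nat list\<close>.\<close>

definition burrows_wheeler :: "letter list \<Rightarrow> word \<Rightarrow> word" where
  "burrows_wheeler ord w = map last (sort_key (map (rank ord)) (conjugates w))"

text \<open>For the symmetric permutation, the list $[\pi a_1, \dots, \pi a_r]$ is
  $[a_r, \dots, a_1]$, i.e. \<open>rev ord\<close>.\<close>

definition perfectly_clustering_for :: "letter list \<Rightarrow> word \<Rightarrow> bool" where
  "perfectly_clustering_for ord w \<longleftrightarrow>
     burrows_wheeler ord w = concat (map (\<lambda>x. replicate (count_list w x) x) (rev ord))"

definition perfectly_clustering :: "word \<Rightarrow> bool" where
  "perfectly_clustering w \<longleftrightarrow> (\<exists>ord. alphabet_order ord \<and> perfectly_clustering_for ord w)"

definition in_ar_range :: "word \<Rightarrow> bool" where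
  "in_ar_range w \<longleftrightarrow> (\<exists>x. w \<in> range (sigma x) \<or> w \<in> range (tau x))"

definition primitive :: "word \<Rightarrow> bool" where
  "primitive w \<longleftrightarrow> \<not> (\<exists>u n. u \<noteq> w \<and> w = concat (replicate n u))"

definition palindrome :: "word \<Rightarrow> bool" where
  "palindrome w \<longleftrightarrow> rev w = w"

text \<open>Insertion of a single \<open>Lb\<close> between each pair of adjacent occurrences of \<open>La\<close> and each
  pair of adjacent occurrences of \<open>Lc\<close>. It is applied to words in which at most one of the
  two kinds of pairs occurs.\<close>

fun insert_b :: "word \<Rightarrow> word" where
  "insert_b (x # y # u) =
     (if x = y \<and> x \<in> {La, Lc} then x # Lb # insert_b (y # u) else x # insert_b (y # u))"
| "insert_b u = u"

definition built_from :: "word \<Rightarrow> word \<Rightarrow> bool" where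
  "built_from v w \<longleftrightarrow> w = [Lb] @ insert_b (tau_word v [Lb])"

definition conj_built_from :: "word \<Rightarrow> word \<Rightarrow> bool" where
  "conj_built_from v w' \<longleftrightarrow> w' = insert_b (tau_word v [Lb]) @ [Lb]"

text \<open>\<open>b_conjugate w w'\<close> says that $w' = b^{-1} w b$, which requires \<open>w\<close> to begin with \<open>Lb\<close>.\<close>

definition b_conjugate :: "word \<Rightarrow> word \<Rightarrow> bool" where
  "b_conjugate w w' \<longleftrightarrow> (\<exists>u. w = Lb # u \<and> w' = u @ [Lb])"

end

theory Submission
  imports Defs "HOL-Library.Multiset" "HOL-Library.Infinite_Set" "HOL-Combinatorics.Transposition"
begin

text \<open>
  Perfect clustering is an order condition on the circular word: whenever one rotation of \<open>w\<close>
  is smaller than another, the letter preceding the smaller one is at least as large as the letter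
  preceding the larger one (lemma \<open>perfectly_clustering_for_iff\<close>). All of clustering is used
  through this condition.

  In a nonempty factor of an Arnoux-Rauzy language some letter \<open>s\<close> separates: of two adjacent
  letters, one is \<open>s\<close>. If the word is in none of the six ranges, it neither begins nor ends
  with \<open>s\<close>, and the order condition for the three pairs of letters around the end points of
  the circular word forces its two end letters to agree; call them \<open>b\<close>, and rename \<open>s\<close> to
  \<open>a\<close>. The pair \<open>bb\<close> now occurs circularly, and two squares of different letters always
  violate the order condition, so \<open>aa\<close> and \<open>cc\<close> do not occur and the word has the form
  \<open>frame u\<close>, that is, \<open>b a sigma_a(u) b\<close>, with \<open>u\<close> a word on \<open>b, c\<close>. Primitivity
  and the position of \<open>b\<close> in the order are all read off this form.

  What remains is to see which \<open>u\<close> make \<open>frame u\<close> clustering. Since \<open>bb\<close> occurs only once in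
  the circular word, it can be used as a marker to cut the circle open, and the condition becomes
  the linear condition \<open>noncrossing u\<close> on the word \<open>a b u a\<close>, whose two letters \<open>a\<close> stand
  for the cut (lemma \<open>perfectly_clustering_frame\<close>). This linear condition is
  invariant under \<open>u \<mapsto> x sigma_x(u)\<close> for \<open>x\<close> in \<open>{b, c}\<close>, because the morphisms preserve
  the lexicographic order (lemma \<open>noncrossing_sigma\<close>), and a nonempty \<open>u\<close> satisfying it is
  always of that form (lemma \<open>noncrossing_Cons\<close>). Hence \<open>u\<close> is noncrossing exactly when it
  is an iterated palindromic closure \<open>pal q\<close> with \<open>q\<close> on \<open>b, c\<close>, that is, a central word.

  On the other side, \<open>tau_v(b) = pal(v) b\<close> for \<open>v\<close> on \<open>a, c\<close>. If \<open>v = a v'\<close>, inserting \<open>b\<close>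
  into each \<open>aa\<close> of \<open>pal(v) b = a sigma_a(pal v') b\<close> amounts to exchanging the letters \<open>a\<close> and
  \<open>b\<close> in the argument of \<open>sigma_a\<close>, so the word built from \<open>v\<close> is \<open>frame (pal q)\<close>, where
  \<open>q\<close> is \<open>v'\<close> with \<open>a\<close> and \<open>b\<close> exchanged. The case \<open>v = c v'\<close> follows by exchanging \<open>a\<close>
  and \<open>c\<close> and reversing the order. So both directions describe the same words. That these are
  Arnoux-Rauzy words follows since \<open>b pal(q) b\<close> is one for every \<open>q\<close>, and \<open>frame u\<close> is a
  prefix of \<open>sigma_a(b u b)\<close>.
\<close>

lemma UNIV_letter: "UNIV = {La, Lb, Lc}"
  by (auto intro: letter.exhaust)

section \<open>The morphisms and palindromic closure\<close>

lemma sigma_simps [simp]: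
  "sigma x [] = []"
  "sigma x (y # w) = (if y = x then x # sigma x w else y # x # sigma x w)"
  "sigma x (u @ v) = sigma x u @ sigma x v"
  by (simp_all add: sigma_def)

lemma tau_simps [simp]:
  "tau x [] = []"
  "tau x (y # w) = (if y = x then x # tau x w else x # y # tau x w)"
  "tau x (u @ v) = tau x u @ tau x v"
  by (simp_all add: tau_def)

text \<open>The morphisms \<open>tau x\<close> and \<open>sigma x\<close> are conjugate by the letter \<open>x\<close>; this lets each
  argument use whichever of the two is more convenient.\<close>

lemma tau_append_letter: "tau x w @ [x] = x # sigma x w"
  by (induction w) auto

lemma rev_sigma: "rev (sigma x w) = tau x (rev w)"
  by (induction w) auto

lemma sigma_map: "inj p \<Longrightarrow> sigma (p x) (map p w) = map p (sigma x w)"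
  by (induction w) (auto simp: inj_eq)

lemma tau_map: "inj p \<Longrightarrow> tau (p x) (map p w) = map p (tau x w)"
  by (induction w) (auto simp: inj_eq)

lemma in_ar_range_map:
  assumes "bij p" and "in_ar_range (map p w)"
  shows "in_ar_range w"
proof -
  have p: "inj p" "surj p"
    using assms(1) by (auto simp: bij_def)
  obtain x u where "map p w = sigma x u \<or> map p w = tau x u"
    using assms(2) by (auto simp: in_ar_range_def)
  moreover obtain x' where "x = p x'"
    using p(2) by (metis surjD)
  moreover obtain u' where "u = map p u'"
    using p(2) by (metis ex_map_conv surj_def)
  ultimately have "w = sigma x' u' \<or> w = tau x' u'"
    using p(1) by (simp add: sigma_map tau_map inj_map_eq_map)
  then show ?thesis
    by (auto simp: in_ar_range_def)
qed

lemma set_sigma: "set w \<subseteq> set (sigma x w)"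
  by (induction w) auto

lemma set_sigma_subset: "set (sigma x w) \<subseteq> insert x (set w)"
  by (induction w) auto

lemma length_sigma: "length w \<le> length (sigma x w)"
  by (induction w) auto

text \<open>The iterated palindromic closure of the directive word, given by Justin's formula. On two
  letters its values are the central words.\<close>

fun pal :: "word \<Rightarrow> word" where
  "pal [] = []"
| "pal (x # q) = x # sigma x (pal q)"

lemma pal_map: "inj p \<Longrightarrow> pal (map p q) = map p (pal q)"
  by (induction q) (auto simp: sigma_map)

lemma rev_pal: "rev (pal q) = pal q"
  by (induction q) (auto simp: rev_sigma tau_append_letter)

lemma set_pal: "set (pal q) = set q"
proof (induction q)
  case (Cons x q)
  then show ?case
    using set_sigma[of "pal q" x] set_sigma_subset[of x "pal q"] by auto
qed simp

lemma tau_word_simps [simp]: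
  "tau_word [] u = u"
  "tau_word (x # v) u = tau x (tau_word v u)"
  by (simp_all add: tau_word_def)

text \<open>A letter \<open>y\<close> foreign to the directive word only collects the letters pushed in front of it,
  and these accumulate to the palindromic closure.\<close>

lemma tau_word_new_letter: "y \<notin> set v \<Longrightarrow> tau_word v [y] = pal v @ [y]"
proof (induction v)
  case (Cons x v)
  then show ?case
    using tau_append_letter[of x "pal v"] by auto
qed simp

section \<open>Letters with their right contexts\<close>

text \<open>The order conditions below relate a letter to the word that follows it. Keeping the pair of both,
  one for each position of the word, makes the effect of a morphism on them a simple recursion.\<close>

fun tails :: "word \<Rightarrow> (letter \<times> word) set" where
  "tails [] = {}"
| "tails (x # s) = insert (x, s) (tails s)"

lemma tails_iff: "(x, s) \<in> tails w \<longleftrightarrow> (\<exists>p. w = p @ x # s)"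
  by (induction w) (auto simp: Cons_eq_append_conv)

lemma tails_append: "(x, s) \<in> tails u \<Longrightarrow> (x, s @ v) \<in> tails (u @ v)"
  by (auto simp: tails_iff)

lemma tails_Cons_tails: "(x, y # s) \<in> tails w \<Longrightarrow> (y, s) \<in> tails w"
  by (auto simp: tails_iff)

lemma tails_predecessor:
  assumes "(y, s) \<in> tails w"
  shows "w = y # s \<or> (\<exists>z. (z, y # s) \<in> tails w)"
proof -
  obtain p where "w = p @ y # s"
    using assms by (auto simp: tails_iff)
  then show ?thesis
    by (cases p rule: rev_cases) (auto simp: tails_iff)
qed

text \<open>A position in \<open>tau x w\<close> is either the last letter of a block, where both components come from
  \<open>w\<close>, or the letter \<open>x\<close> that opens a block of length two.\<close>

lemma tails_tau:
  "(z, s) \<in> tails (tau x w) \<longleftrightarrow>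
     (\<exists>y t. (y, t) \<in> tails w \<and> (z = y \<and> s = tau x t \<or> y \<noteq> x \<and> z = x \<and> s = y # tau x t))"
  by (induction w) auto

lemma range_sigmaI:
  assumes "\<And>y s. (y, s) \<in> tails u \<Longrightarrow> y \<noteq> x \<Longrightarrow> s \<noteq> [] \<and> hd s = x"
  obtains u' where "u = sigma x u'"
proof -
  have "\<exists>u'. u = sigma x u'"
    using assms
  proof (induction u rule: induct_list012)
    case 1
    then show ?case by (intro exI[of _ "[]"]) simp
  next
    case (2 y)
    then have "y = x"
      by force
    then show ?case
      by (intro exI[of _ "[y]"]) simp
  next
    case (3 y z u)
    show ?case
    proof (cases "y = x")
      case True
      obtain u' where "z # u = sigma x u'"
        using 3(2) 3(3) by force
      with True show ?thesis
        by (intro exI[of _ "x # u'"]) simp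
    next
      case False
      then have "z = x"
        using 3(3)[of y "z # u"] by simp
      moreover obtain u' where "u = sigma x u'"
        using 3(1) 3(3) by force
      ultimately show ?thesis
        using False by (intro exI[of _ "y # u'"]) simp
    qed
  qed
  then show ?thesis
    using that by blast
qed

abbreviation separated_by :: "letter \<Rightarrow> word \<Rightarrow> bool" where
  "separated_by x \<equiv> successively (\<lambda>y z. y = x \<or> z = x)"

lemma separated_tails:
  "separated_by x w \<Longrightarrow> (y, s) \<in> tails w \<Longrightarrow> y \<noteq> x \<Longrightarrow> s = [] \<and> y = last w \<or> s \<noteq> [] \<and> hd s = x"
  by (induction w) (auto simp: successively_Cons)

text \<open>A separated word fails to be a product of blocks \<open>x\<close> and \<open>yx\<close> only if it ends in another
  letter, and fails to be a product of blocks \<open>x\<close> and \<open>xy\<close> only if it begins with another one.\<close>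

lemma separated_in_ar_range:
  assumes "separated_by x w" and "w = [] \<or> hd w = x \<or> last w = x"
  shows "in_ar_range w"
proof -
  have sig: "\<exists>u'. u = sigma x u'" if "separated_by x u" "u = [] \<or> last u = x" for u
  proof (rule range_sigmaI[of u x])
    fix y s
    assume "(y, s) \<in> tails u" "y \<noteq> x"
    then show "s \<noteq> [] \<and> hd s = x"
      using separated_tails[OF that(1)] that(2) by fastforce
  qed blast
  show ?thesis
  proof (cases "w = [] \<or> last w = x")
    case True
    then show ?thesis
      using sig[OF assms(1)] by (auto simp: in_ar_range_def)
  next
    case False
    then have "\<exists>u'. rev w = sigma x u'"
      using assms by (intro sig) (auto simp: last_rev disj_commute)
    then obtain u' where "w = tau x (rev u')"
      by (metis rev_sigma rev_rev_ident)
    then show ?thesis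
      by (auto simp: in_ar_range_def)
  qed
qed

lemma separated_letter_sigma: "separated_by x (x # sigma x w)"
  by (induction w) (auto simp: successively_Cons)

lemma in_ar_range_separated:
  assumes "in_ar_range w" and "w \<noteq> []"
  shows "\<exists>x. separated_by x w \<and> (hd w = x \<or> last w = x)"
proof -
  obtain x u where "w = sigma x u \<or> w = tau x u"
    using assms(1) by (auto simp: in_ar_range_def)
  then show ?thesis
  proof
    assume w: "w = sigma x u"
    have "last (x # sigma x u) = x"
      by (simp flip: tau_append_letter)
    then show ?thesis
      using separated_letter_sigma[of x u] assms(2) w by (auto simp: successively_Cons)
  next
    assume w: "w = tau x u"
    have "separated_by x (tau x u @ [x])"
      by (simp only: tau_append_letter separated_letter_sigma)
    moreover have "hd (tau x u @ [x]) = x"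
      by (simp only: tau_append_letter list.sel)
    ultimately show ?thesis
      using assms(2) w by (auto simp: successively_append_iff)
  qed
qed

section \<open>Comparing words at their first difference\<close>

text \<open>Both words must differ at some common position. In contrast to the usual lexicographic order a
  proper prefix is not smaller, so the comparison survives appending arbitrary words.\<close>

fun lex_less :: "(letter \<Rightarrow> nat) \<Rightarrow> word \<Rightarrow> word \<Rightarrow> bool" where
  "lex_less f (y # s) (z # t) = (if y = z then lex_less f s t else f y < f z)"
| "lex_less f _ _ = False"

lemma lex_less_irrefl [simp]: "\<not> lex_less f u u"
  by (induction u) auto

lemma lex_less_asym: "lex_less f u v \<Longrightarrow> \<not> lex_less f v u"
  by (induction f u v rule: lex_less.induct) auto

lemma lex_less_Nil2 [simp]: "\<not> lex_less f u []"
  by (cases u) auto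

lemma lex_less_append: "lex_less f u v \<Longrightarrow> lex_less f (u @ u') (v @ v')"
  by (induction f u v rule: lex_less.induct) auto

lemma lex_less_append_same:
  "length u = length v \<Longrightarrow> lex_less f (u @ w) (v @ w) \<longleftrightarrow> lex_less f u v"
  by (induction u v rule: list_induct2) auto

lemma lex_less_map:
  "length u = length v \<Longrightarrow> inj f \<Longrightarrow> map f u < map f v \<longleftrightarrow> lex_less f u v"
  by (induction u v rule: list_induct2) (auto simp: inj_eq)

text \<open>The letter \<open>La\<close> will serve as an end marker. Words in which it occurs exactly once, at the
  end, are never proper prefixes of each other, so \<open>lex_less\<close> is total on them.\<close>

fun ends_at_a :: "word \<Rightarrow> bool" where
  "ends_at_a [] = False"
| "ends_at_a (y # s) = (if y = La then s = [] else ends_at_a s)"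

lemma ends_at_a_append: "La \<notin> set u \<Longrightarrow> ends_at_a (u @ [La])"
  by (induction u) auto

lemma ends_at_a_tails:
  "ends_at_a w \<Longrightarrow> (y, t) \<in> tails w \<Longrightarrow> (if y = La then t = [] else ends_at_a t)"
  by (induction w) (auto split: if_splits)

lemma lex_less_total:
  "inj f \<Longrightarrow> ends_at_a s \<Longrightarrow> ends_at_a t \<Longrightarrow> s \<noteq> t \<Longrightarrow> lex_less f s t \<or> lex_less f t s"
proof (induction f s t rule: lex_less.induct)
  case (1 f y s z t)
  then show ?case
    by (auto split: if_splits) (metis injD linorder_neqE_nat)+
qed auto

lemma hd_tau: "w \<noteq> [] \<Longrightarrow> \<exists>r. tau x w = x # r"
  by (cases w) auto

text \<open>If one word goes on with \<open>x\<close> and the other with \<open>y \<noteq> x\<close>, their images go on with \<open>x\<close>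
  followed by the next block, and with \<open>x y\<close>. The next block begins with \<open>x\<close> and exists because
  the marker is still to come, hence the comparison is again between \<open>x\<close> and \<open>y\<close>.\<close>

lemma lex_less_tau:
  assumes "x \<noteq> La"
  shows "ends_at_a s \<Longrightarrow> ends_at_a t \<Longrightarrow> lex_less f (tau x s) (tau x t) \<longleftrightarrow> lex_less f s t"
proof (induction f s t rule: lex_less.induct)
  case (1 f y s z t)
  have s: "\<exists>r. tau x s = x # r" if "y \<noteq> La"
    using 1(2) that by (intro hd_tau) auto
  have t: "\<exists>r. tau x t = x # r" if "z \<noteq> La"
    using 1(3) that by (intro hd_tau) auto
  show ?case
    using 1 assms s t by (cases "y = z"; cases "z = La") auto
qed auto

section \<open>Clustering as an order condition\<close>

lemma alphabet_order_cases:
  assumes "alphabet_order ord"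
  obtains x y z where "ord = [x, y, z]" "x \<noteq> y" "x \<noteq> z" "y \<noteq> z" "{x, y, z} = UNIV"
proof -
  have d: "distinct ord" "set ord = {La, Lb, Lc}"
    using assms by (auto simp: alphabet_order_def UNIV_letter)
  then have "length ord = 3"
    using distinct_card[of ord] by simp
  then obtain x y z where "ord = [x, y, z]"
    by (auto simp: length_Suc_conv numeral_3_eq_3)
  then show ?thesis
    using d that UNIV_letter by auto
qed

lemma inj_rank:
  assumes "alphabet_order ord"
  shows "inj (rank ord)"
proof (rule injI)
  have "x \<in> set xs \<Longrightarrow> xs ! rank xs x = x" for x xs
    by (induction xs) (auto simp: rank_def)
  then have nth: "ord ! rank ord x = x" for x
    using assms by (simp add: alphabet_order_def)
  show "x = y" if "rank ord x = rank ord y" for x y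
    using nth that by metis
qed

text \<open>For a suffix \<open>s\<close> of \<open>w\<close>, the conjugate of \<open>w\<close> that begins with this occurrence of \<open>s\<close>.
  Its last letter is the one that precedes \<open>s\<close>.\<close>

definition rotation_from :: "word \<Rightarrow> word \<Rightarrow> word" where
  "rotation_from w s = s @ take (length w - length s) w"

lemma rotation_from_decomp: "rotation_from (p @ x # s) s = s @ p @ [x]"
  by (simp add: rotation_from_def)

lemma length_rotation_from: "length s \<le> length w \<Longrightarrow> length (rotation_from w s) = length w"
  by (simp add: rotation_from_def)

lemma set_conjugates: "set (conjugates w) = {rotation_from w s | x s. (x, s) \<in> tails w}"
proof (intro equalityI subsetI)
  fix c
  assume "c \<in> set (conjugates w)"
  then obtain i where i: "i < length w" "c = rotate i w"
    by (auto simp: conjugates_def)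
  \<comment> \<open>The unrotated word is the one that begins after the last letter, with \<open>s = []\<close>.\<close>
  define j where "j = (if i = 0 then length w else i)"
  have j: "0 < j" "j \<le> length w"
    using i by (auto simp: j_def)
  have "c = drop j w @ take j w"
    using i by (cases "i = 0") (auto simp: j_def rotate_drop_take)
  then have "c = rotation_from w (drop j w)"
    using j by (simp add: rotation_from_def)
  moreover have "w = take (j - 1) w @ w ! (j - 1) # drop j w"
    using j id_take_nth_drop[of "j - 1" w] by simp
  ultimately show "c \<in> {rotation_from w s | x s. (x, s) \<in> tails w}"
    by (auto simp: tails_iff)
next
  fix c
  assume "c \<in> {rotation_from w s | x s. (x, s) \<in> tails w}"
  then obtain p x s where w: "w = p @ x # s" and c: "c = s @ p @ [x]"
    by (auto simp: tails_iff rotation_from_decomp)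
  have "c = rotate (Suc (length p)) w"
    using rotate_append[of "p @ [x]" s] by (simp add: w c)
  also have "\<dots> = rotate (Suc (length p) mod length w) w"
    by (rule rotate_conv_mod)
  finally have "c = rotate (Suc (length p) mod length w) w" .
  moreover have "Suc (length p) mod length w < length w"
    by (simp only: w length_append list.size) simp
  ultimately show "c \<in> set (conjugates w)"
    by (simp add: conjugates_def)
qed

lemma map_last_conjugates: "map last (conjugates w) = rotate (length w - 1) w"
proof (rule nth_equalityI)
  fix i
  assume "i < length (map last (conjugates w))"
  then have i: "i < length w"
    by (simp add: conjugates_def)
  then have "rotate i w \<noteq> []"
    by auto
  then have "last (rotate i w) = w ! ((i + (length w - 1)) mod length w)"
    using i by (simp add: last_conv_nth nth_rotate)
  then show "map last (conjugates w) ! i = rotate (length w - 1) w ! i"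
    using i by (simp add: conjugates_def nth_rotate add.commute)
qed (simp add: conjugates_def)

lemma sorted_wrt_replicate: "P x x \<Longrightarrow> sorted_wrt P (replicate n x)"
  by (induction n) auto

text \<open>The transform is a rearrangement of \<open>w\<close>, and the clustered word is the only rearrangement that
  is sorted decreasingly.\<close>

lemma perfectly_clustering_for_sorted:
  assumes "alphabet_order ord"
  shows "perfectly_clustering_for ord w \<longleftrightarrow>
           sorted_wrt (\<lambda>x y. rank ord y \<le> rank ord x) (burrows_wheeler ord w)"
proof -
  define R where "R = concat (map (\<lambda>x. replicate (count_list w x) x) (rev ord))"
  define B where "B = burrows_wheeler ord w"
  obtain x y z where ord: "ord = [x, y, z]" and xyz: "x \<noteq> y" "x \<noteq> z" "y \<noteq> z" "{x, y, z} = UNIV"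
    using assms by (rule alphabet_order_cases)
  have sR: "sorted_wrt (\<lambda>x y. rank ord y \<le> rank ord x) R"
    using xyz(1-3) by (auto simp: R_def ord sorted_wrt_append sorted_wrt_replicate rank_def)
  have "mset B = mset w"
  proof -
    have "mset B = mset (map last (conjugates w))"
      by (simp only: B_def burrows_wheeler_def mset_map mset_sort)
    also have "\<dots> = mset w"
      unfolding map_last_conjugates rotate_drop_take mset_append
      by (metis append_take_drop_id mset_append add.commute)
    finally show ?thesis .
  qed
  moreover have "mset R = mset w"
  proof (rule multiset_eqI)
    fix l
    have "l \<in> {x, y, z}"
      by (simp only: xyz(4) UNIV_I)
    then show "count (mset R) l = count (mset w) l"
      using xyz(1-3) by (auto simp: R_def ord count_mset)
  qed
  ultimately have m: "mset B = mset R"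
    by simp
  have "B = R" if s: "sorted_wrt (\<lambda>x y. rank ord y \<le> rank ord x) B"
  proof -
    have "mset (rev (map (rank ord) B)) = mset (rev (map (rank ord) R))"
      using m by simp
    moreover have "sorted (rev (map (rank ord) B))" "sorted (rev (map (rank ord) R))"
      using s sR by (simp_all add: sorted_wrt_rev sorted_wrt_map)
    ultimately have "rev (map (rank ord) B) = rev (map (rank ord) R)"
      by (metis properties_for_sort sorted_sort_id)
    then show ?thesis
      using inj_rank[OF assms] by (simp add: inj_map_eq_map)
  qed
  moreover have "perfectly_clustering_for ord w \<longleftrightarrow> B = R"
    by (simp only: perfectly_clustering_for_def R_def B_def)
  ultimately show ?thesis
    using sR by (metis B_def)
qed

text \<open>Reading last letters along the sorted list of conjugates gives a decreasing sequence exactly when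
  this holds for each two comparable conjugates; equal conjugates have equal last letters.\<close>

lemma perfectly_clustering_for_iff:
  assumes "alphabet_order ord"
  shows "perfectly_clustering_for ord w \<longleftrightarrow>
           (\<forall>x s x' s'. (x, s) \<in> tails w \<longrightarrow> (x', s') \<in> tails w \<longrightarrow>
              lex_less (rank ord) (rotation_from w s) (rotation_from w s') \<longrightarrow>
              rank ord x' \<le> rank ord x)"
    (is "_ \<longleftrightarrow> ?order")
proof -
  define L where "L = sort_key (map (rank ord)) (conjugates w)"
  have setL: "set L = set (conjugates w)"
    by (simp add: L_def)
  have sL: "map (rank ord) (L ! i) \<le> map (rank ord) (L ! j)" if "i < j" "j < length L" for i j
  proof -
    have "sorted (map (map (rank ord)) L)"
      by (simp add: L_def)
    then show ?thesis
      using that sorted_nth_mono[of "map (map (rank ord)) L" i j] by simp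
  qed
  have mem: "c \<in> set L \<longleftrightarrow> (\<exists>x s. (x, s) \<in> tails w \<and> c = rotation_from w s)" for c
    by (auto simp: setL set_conjugates)
  have len: "length c = length w" if "c \<in> set L" for c
    using that by (auto simp: setL conjugates_def)
  have last: "last (rotation_from w s) = x" if "(x, s) \<in> tails w" for x s
    using that by (auto simp: tails_iff rotation_from_decomp)
  have less: "map (rank ord) c < map (rank ord) c' \<longleftrightarrow> lex_less (rank ord) c c'"
    if "c \<in> set L" "c' \<in> set L" for c c'
    using len[OF that(1)] len[OF that(2)] by (intro lex_less_map inj_rank assms) simp
  have clus: "perfectly_clustering_for ord w \<longleftrightarrow>
      (\<forall>i j. i < j \<longrightarrow> j < length L \<longrightarrow> rank ord (last (L ! j)) \<le> rank ord (last (L ! i)))"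
    by (simp add: perfectly_clustering_for_sorted[OF assms] burrows_wheeler_def
        sorted_wrt_map sorted_wrt_iff_nth_less flip: L_def)
  show ?thesis
  proof
    assume pc: "perfectly_clustering_for ord w"
    show ?order
    proof (intro allI impI)
      fix x s x' s'
      assume xs: "(x, s) \<in> tails w" "(x', s') \<in> tails w"
        and "lex_less (rank ord) (rotation_from w s) (rotation_from w s')"
      moreover obtain i where i: "i < length L" "L ! i = rotation_from w s"
        using mem xs(1) by (metis in_set_conv_nth)
      moreover obtain j where j: "j < length L" "L ! j = rotation_from w s'"
        using mem xs(2) by (metis in_set_conv_nth)
      ultimately have lt: "map (rank ord) (L ! i) < map (rank ord) (L ! j)"
        using less[of "L ! i" "L ! j"] nth_mem[of i L] nth_mem[of j L] by simp
      then have "i < j"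
        using sL[of j i] i(1) by (cases i j rule: linorder_cases) auto
      then have "rank ord (last (L ! j)) \<le> rank ord (last (L ! i))"
        using clus pc j(1) by blast
      then show "rank ord x' \<le> rank ord x"
        by (simp add: i j last[OF xs(1)] last[OF xs(2)])
    qed
  next
    assume ord: ?order
    have "rank ord (last (L ! j)) \<le> rank ord (last (L ! i))"
      if ij: "i < j" "j < length L" for i j
    proof -
      have mems: "L ! i \<in> set L" "L ! j \<in> set L"
        using ij by auto
      obtain x s where xs: "(x, s) \<in> tails w" "L ! i = rotation_from w s"
        using mem mems(1) by auto
      obtain x' s' where xs': "(x', s') \<in> tails w" "L ! j = rotation_from w s'"
        using mem mems(2) by auto
      consider "map (rank ord) (L ! i) < map (rank ord) (L ! j)"
        | "map (rank ord) (L ! i) = map (rank ord) (L ! j)"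
        using sL[OF ij] by fastforce
      then show ?thesis
      proof cases
        case 1
        then have "lex_less (rank ord) (rotation_from w s) (rotation_from w s')"
          using less mems xs xs' by simp
        then show ?thesis
          using ord xs xs' last[OF xs(1)] last[OF xs'(1)] by fastforce
      next
        case 2
        then show ?thesis
          using inj_rank[OF assms] by (simp add: inj_map_eq_map)
      qed
    qed
    then show "perfectly_clustering_for ord w"
      using clus by simp
  qed
qed

text \<open>Clustering is transported by renaming letters and by reversing the order, which removes the need to
  treat symmetric cases separately.\<close>

lemma rank_map: "inj p \<Longrightarrow> rank (map p ord) (p x) = rank ord x"
  by (simp add: rank_def takeWhile_map comp_def inj_eq)

lemma lex_less_rank_map:
  "inj p \<Longrightarrow> lex_less (rank (map p ord)) (map p u) (map p v) \<longleftrightarrow> lex_less (rank ord) u v"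
  by (induction "rank ord" u v rule: lex_less.induct) (auto simp: inj_eq rank_map)

lemma alphabet_order_map: "bij p \<Longrightarrow> alphabet_order ord \<Longrightarrow> alphabet_order (map p ord)"
  by (auto simp: alphabet_order_def distinct_map bij_def inj_on_def)

lemma tails_map: "tails (map p w) = (\<lambda>(x, s). (p x, map p s)) ` tails w"
  by (induction w) auto

lemma rotation_from_map: "rotation_from (map p w) (map p s) = map p (rotation_from w s)"
  by (simp add: rotation_from_def take_map)

lemma perfectly_clustering_for_map:
  assumes "bij p" and "alphabet_order ord" and "perfectly_clustering_for ord w"
  shows "perfectly_clustering_for (map p ord) (map p w)"
proof -
  have p: "inj p"
    using assms(1) by (simp add: bij_def)
  show ?thesis
    unfolding perfectly_clustering_for_iff[OF alphabet_order_map[OF assms(1,2)]]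
  proof (intro allI impI)
    fix x s x' s'
    assume "(x, s) \<in> tails (map p w)" "(x', s') \<in> tails (map p w)"
      and less: "lex_less (rank (map p ord)) (rotation_from (map p w) s) (rotation_from (map p w) s')"
    then obtain y t y' t' where
      "(y, t) \<in> tails w" "x = p y" "s = map p t" "(y', t') \<in> tails w" "x' = p y'" "s' = map p t'"
      by (auto simp: tails_map)
    with less show "rank (map p ord) x' \<le> rank (map p ord) x"
      using perfectly_clustering_for_iff[OF assms(2)] assms(3)
      by (simp add: p rotation_from_map lex_less_rank_map rank_map)
  qed
qed

lemma alphabet_order_rev: "alphabet_order ord \<Longrightarrow> alphabet_order (rev ord)"
  by (simp add: alphabet_order_def)

lemma rank_rev:
  assumes "alphabet_order ord"
  shows "rank (rev ord) x \<le> rank (rev ord) y \<longleftrightarrow> rank ord y \<le> rank ord x"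
    and "rank (rev ord) x < rank (rev ord) y \<longleftrightarrow> rank ord y < rank ord x"
proof -
  obtain u v w where ord: "ord = [u, v, w]" and uvw: "u \<noteq> v" "u \<noteq> w" "v \<noteq> w" "{u, v, w} = UNIV"
    using assms by (rule alphabet_order_cases)
  have "x \<in> {u, v, w}" "y \<in> {u, v, w}"
    by (simp_all only: uvw(4) UNIV_I)
  then show "rank (rev ord) x \<le> rank (rev ord) y \<longleftrightarrow> rank ord y \<le> rank ord x"
    and "rank (rev ord) x < rank (rev ord) y \<longleftrightarrow> rank ord y < rank ord x"
    using uvw(1-3) by (auto simp: ord rank_def)
qed

lemma lex_less_rank_rev:
  assumes "alphabet_order ord"
  shows "lex_less (rank (rev ord)) u v \<longleftrightarrow> lex_less (rank ord) v u"
  by (induction "rank ord" u v rule: lex_less.induct) (auto simp: rank_rev[OF assms])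

lemma perfectly_clustering_for_rev:
  assumes "alphabet_order ord" and "perfectly_clustering_for ord w"
  shows "perfectly_clustering_for (rev ord) w"
  using assms(2)
  unfolding perfectly_clustering_for_iff[OF alphabet_order_rev[OF assms(1)]]
    perfectly_clustering_for_iff[OF assms(1)] rank_rev[OF assms(1)] lex_less_rank_rev[OF assms(1)]
  by blast

text \<open>The order condition for two circular factors of length two: each letter of \<open>w\<close> is followed by
  the head of \<open>s @ w\<close>, since after the end the word starts again. It is all that is needed to
  determine the shape of the clustering words.\<close>

lemma clustering_adjacent:
  assumes "alphabet_order ord" and "perfectly_clustering_for ord w"
    and "(x, s) \<in> tails w" and "(x', s') \<in> tails w"
    and "rank ord (hd (s @ w)) < rank ord (hd (s' @ w))"
  shows "rank ord x' \<le> rank ord x"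
proof -
  have hd: "\<exists>r. rotation_from w t = hd (t @ w) # r" if "(y, t) \<in> tails w" for y t
    using that by (cases t; cases w) (auto simp: rotation_from_def)
  obtain r r' where "rotation_from w s = hd (s @ w) # r" "rotation_from w s' = hd (s' @ w) # r'"
    using hd[OF assms(3)] hd[OF assms(4)] by blast
  then have "lex_less (rank ord) (rotation_from w s) (rotation_from w s')"
    using assms(5) by auto
  then show ?thesis
    using assms(2-4) unfolding perfectly_clustering_for_iff[OF assms(1)] by blast
qed

section \<open>The order condition on two letters\<close>

text \<open>The two rankings are inherited from the order \<open>a < b < c\<close> of the framed word, in which each
  letter \<open>b\<close> or \<open>c\<close> of \<open>u\<close> becomes the block \<open>ba\<close> or \<open>ca\<close>, while the marker becomes a \<open>b\<close>
  that is followed by another \<open>b\<close>. Comparing \<open>ba\<close>, \<open>bb\<close>, \<open>ca\<close> ranks the followers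
  as \<open>b\<close>, marker, \<open>c\<close>. Among the leading letters, clustering reverses \<open>b < c\<close>, and the marker
  comes least.\<close>

fun follower_rank :: "letter \<Rightarrow> nat" where
  "follower_rank Lb = 0"
| "follower_rank La = 1"
| "follower_rank Lc = 2"

fun leader_rank :: "letter \<Rightarrow> nat" where
  "leader_rank La = 0"
| "leader_rank Lc = 1"
| "leader_rank Lb = 2"

lemma inj_follower_rank: "inj follower_rank"
  by (rule injI) (metis follower_rank.simps letter.exhaust numeral_One one_neq_zero zero_neq_numeral
      numeral_eq_iff semiring_norm(85))

definition marked :: "word \<Rightarrow> word" where
  "marked y = Lb # y @ [La]"

text \<open>The letter \<open>La\<close> in front marks the left end of the word, where the circle is cut; it is the
  leading letter of the whole word \<open>marked u\<close>.\<close>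

definition noncrossing :: "word \<Rightarrow> bool" where
  "noncrossing u \<longleftrightarrow>
     (\<forall>x s x' s'. (x, s) \<in> tails (La # marked u) \<longrightarrow> (x', s') \<in> tails (La # marked u) \<longrightarrow>
        lex_less follower_rank s s' \<longrightarrow> leader_rank x \<le> leader_rank x')"

lemma noncrossingD:
  "noncrossing u \<Longrightarrow> (x, s) \<in> tails (La # marked u) \<Longrightarrow> (x', s') \<in> tails (La # marked u) \<Longrightarrow>
     lex_less follower_rank s s' \<Longrightarrow> leader_rank x \<le> leader_rank x'"
  unfolding noncrossing_def by blast

lemma ends_at_a_marked: "La \<notin> set u \<Longrightarrow> ends_at_a (marked u)"
  by (simp add: marked_def ends_at_a_append)

lemma ends_at_a_tails_marked:
  assumes "La \<notin> set u" and "(x, s) \<in> tails (La # marked u)" and "s \<noteq> []"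
  shows "ends_at_a s"
  using assms ends_at_a_marked[of u] ends_at_a_tails[of "marked u" x s] by (auto split: if_splits)

lemma tails_marked_La:
  "La \<notin> set u \<Longrightarrow> (La, s) \<in> tails (marked u) \<Longrightarrow> s = []"
  using ends_at_a_marked ends_at_a_tails by fastforce

lemma tau_marked:
  "tau x (marked u) = (if x = Lb then [] else [x]) @ marked (x # sigma x u)" if "x \<noteq> La"
  using that tau_append_letter[of x u] by (auto simp: marked_def)

text \<open>The pairs of \<open>marked u\<close> correspond to pairs of its image with the same leading letter, and
  \<open>tau Lb\<close> preserves the order. The only other pairs of the image come from the letters \<open>b\<close> that
  open a block of length two. Their leading letter has the largest rank, so they can only violate the
  condition as the smaller one of two; but they are followed by a letter other than \<open>b\<close>, whereas
  each remaining nonempty right context begins with the least letter \<open>b\<close>.\<close>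

lemma noncrossing_sigma_Lb:
  assumes u: "La \<notin> set u"
  shows "noncrossing (Lb # sigma Lb u) \<longleftrightarrow> noncrossing u"
proof -
  have tau: "marked (Lb # sigma Lb u) = tau Lb (marked u)"
    by (simp add: tau_marked)
  have mono: "lex_less follower_rank (tau Lb s) (tau Lb s') \<longleftrightarrow> lex_less follower_rank s s'"
    if "(x, s) \<in> tails (La # marked u)" "(x', s') \<in> tails (La # marked u)" for x s x' s'
  proof (cases "s = [] \<or> s' = []")
    case False
    then show ?thesis
      using that u by (intro lex_less_tau ends_at_a_tails_marked) auto
  qed auto
  show ?thesis
  proof
    assume nc: "noncrossing u"
    have shape: "(\<exists>t. (x, t) \<in> tails (La # marked u) \<and> s = tau Lb t) \<or>
        x = Lb \<and> (\<exists>y t. y \<noteq> Lb \<and> s = y # t)"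
      if "(x, s) \<in> tails (La # marked (Lb # sigma Lb u))" for x s
      using that by (auto simp: tau tails_tau)
    show "noncrossing (Lb # sigma Lb u)"
      unfolding noncrossing_def
    proof (intro allI impI)
      fix x s x' s'
      assume x: "(x, s) \<in> tails (La # marked (Lb # sigma Lb u))"
        and x': "(x', s') \<in> tails (La # marked (Lb # sigma Lb u))"
        and less: "lex_less follower_rank s s'"
      show "leader_rank x \<le> leader_rank x'"
      proof (cases "x' = Lb")
        case True
        then show ?thesis
          by (cases x) auto
      next
        case False
        then obtain t' where t': "(x', t') \<in> tails (La # marked u)" "s' = tau Lb t'"
          using shape[OF x'] by auto
        have "t' \<noteq> []"
          using less t' by auto
        then obtain r where "s' = Lb # r"
          using t'(2) hd_tau by blast
        then have "\<not> (\<exists>y t. y \<noteq> Lb \<and> s = y # t)"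
          using less by auto
        then obtain t where "(x, t) \<in> tails (La # marked u)" "s = tau Lb t"
          using shape[OF x] by auto
        then show ?thesis
          using nc t' less mono noncrossingD by blast
      qed
    qed
  next
    assume nc: "noncrossing (Lb # sigma Lb u)"
    have lift: "(x, tau Lb t) \<in> tails (La # marked (Lb # sigma Lb u))"
      if "(x, t) \<in> tails (La # marked u)" for x t
      using that by (auto simp: tau tails_tau)
    show "noncrossing u"
      unfolding noncrossing_def using lift mono noncrossingD[OF nc] by blast
  qed
qed

text \<open>Here the image of \<open>marked u\<close> under \<open>tau Lc\<close> has one letter \<open>c\<close> too many in front. This
  affects only the condition for the left marker, which says that \<open>marked u\<close> is smaller than each
  of its proper nonempty suffixes, and this is carried over separately. The remaining pairs
  are those of \<open>marked u\<close>, with the same leading letter and a right context that begins with the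
  largest letter \<open>c\<close>, and those led by a \<open>c\<close> that opens a block of length two; the latter are
  followed by a smaller letter and so are never the larger one of two when the other is
  led by \<open>b\<close>.\<close>

lemma noncrossing_sigma_Lc:
  assumes u: "La \<notin> set u"
  shows "noncrossing (Lc # sigma Lc u) \<longleftrightarrow> noncrossing u"
proof -
  define T where "T = marked (Lc # sigma Lc u)"
  have tau: "tau Lc (marked u) = Lc # T"
    by (simp add: tau_marked T_def)
  have T: "T = Lb # Lc # sigma Lc u @ [La]"
    by (simp add: T_def marked_def)
  have whole: "(x, T) \<notin> tails T" for x
    by (auto simp: tails_iff)
  have mono: "lex_less follower_rank (tau Lc s) (tau Lc s') \<longleftrightarrow> lex_less follower_rank s s'"
    if "(x, s) \<in> tails (La # marked u)" "(x', s') \<in> tails (La # marked u)" for x s x' s'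
  proof (cases "s = [] \<or> s' = []")
    case False
    then show ?thesis
      using that u by (intro lex_less_tau ends_at_a_tails_marked) auto
  qed auto
  have first: "\<exists>r. tau Lc t = Lc # r" if "t \<noteq> []" for t
    using that by (rule hd_tau)
  show ?thesis
  proof
    assume nc: "noncrossing u"
    have shape: "(\<exists>t. (x, t) \<in> tails (marked u) \<and> s = tau Lc t) \<or>
        x = Lc \<and> (s = [La] \<or> (\<exists>t. (Lb, t) \<in> tails (marked u) \<and> s = Lb # tau Lc t))"
      if "(x, s) \<in> tails T" for x s
    proof -
      have "(x, s) \<in> tails (tau Lc (marked u))"
        using that by (simp add: tau)
      then obtain y t where y: "(y, t) \<in> tails (marked u)"
        "x = y \<and> s = tau Lc t \<or> y \<noteq> Lc \<and> x = Lc \<and> s = y # tau Lc t"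
        by (auto simp: tails_tau)
      then show ?thesis
        using tails_marked_La[OF u, of t] by (cases y) auto
    qed
    \<comment> \<open>The condition for the left marker, pulled back to \<open>marked u\<close> by removing one letter \<open>c\<close>
      in front of both words.\<close>
    have least: "\<not> lex_less follower_rank s T" if xs: "(x, s) \<in> tails T" for x s
    proof
      assume less: "lex_less follower_rank s T"
      then have "s \<noteq> [La]" and "\<nexists>r. s = Lc # r" and "s \<noteq> []"
        by (auto simp: T)
      then obtain t where t: "(Lb, t) \<in> tails (marked u)" "s = Lb # tau Lc t"
        using shape[OF xs] first by (metis tau_simps(1))
      have "t \<noteq> []"
        using less xs whole t(2) by (auto simp: T)
      then have t': "(Lb, t) \<in> tails (La # marked u)" "ends_at_a t"
        using ends_at_a_tails_marked[OF u] t(1) by auto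
      have m: "lex_less follower_rank (tau Lc (Lb # t)) (tau Lc (marked u))"
        using less by (simp add: t(2) tau)
      consider "marked u = Lb # t" | z where "(z, Lb # t) \<in> tails (marked u)"
        using tails_predecessor[OF t(1)] by auto
      then show False
      proof cases
        case 1
        then show ?thesis
          using m by simp
      next
        case (2 z)
        then have "lex_less follower_rank (Lb # t) (marked u)"
          using m mono[of z "Lb # t" La "marked u"] by simp
        then have "leader_rank z \<le> leader_rank La"
          using noncrossingD[OF nc, of z "Lb # t" La "marked u"] 2 by simp
        then have "z = La"
          by (cases z) auto
        then show ?thesis
          using 2 tails_marked_La[OF u] by blast
      qed
    qed
    show "noncrossing (Lc # sigma Lc u)"
      unfolding noncrossing_def T_def[symmetric]
    proof (intro allI impI)
      fix x s x' s'
      assume x: "(x, s) \<in> tails (La # T)" and x': "(x', s') \<in> tails (La # T)"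
        and less: "lex_less follower_rank s s'"
      have s'T: "s' \<noteq> T"
        using least x less by auto
      then have x'T: "(x', s') \<in> tails T"
        using x' by auto
      show "leader_rank x \<le> leader_rank x'"
      proof (cases "x = Lb \<and> x' \<noteq> Lb")
        case True
        then have "(Lb, s) \<in> tails T"
          using x by auto
        then obtain t where t: "(Lb, t) \<in> tails (marked u)" "s = tau Lc t"
          using shape by fastforce
        have "t \<noteq> []"
          using less t(2) by auto
        then obtain r where "s = Lc # r"
          using t(2) first by blast
        then have "\<not> (s' = [La] \<or> (\<exists>t. (Lb, t) \<in> tails (marked u) \<and> s' = Lb # tau Lc t))"
          using less by auto
        then obtain t' where "(x', t') \<in> tails (marked u)" "s' = tau Lc t'"
          using shape[OF x'T] by blast
        then have "leader_rank Lb \<le> leader_rank x'"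
          using noncrossingD[OF nc, of Lb t x' t'] t less mono[of Lb t x' t'] by simp
        then show ?thesis
          using True by simp
      next
        case False
        show ?thesis
        proof (cases "x' = La")
          case True
          then have "s' = []"
            using shape[OF x'T] tails_marked_La[OF u] True by fastforce
          then show ?thesis
            using less by simp
        next
          case 2: False
          then show ?thesis
            using False by (cases x; cases x') auto
        qed
      qed
    qed
  next
    assume nc: "noncrossing (Lc # sigma Lc u)"
    have lift: "(x, tau Lc t) \<in> tails T" if "(x, t) \<in> tails (marked u)" for x t
    proof -
      have "(x, tau Lc t) \<in> tails (Lc # T)"
        using that by (auto simp: tails_tau simp flip: tau)
      moreover have "tau Lc t \<noteq> T"
        using first[of t] by (cases "t = []") (auto simp: T)
      ultimately show ?thesis
        by simp
    qed
    show "noncrossing u"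
      unfolding noncrossing_def
    proof (intro allI impI)
      fix x s x' s'
      assume x: "(x, s) \<in> tails (La # marked u)" and x': "(x', s') \<in> tails (La # marked u)"
        and less: "lex_less follower_rank s s'"
      have less': "lex_less follower_rank (tau Lc s) (tau Lc s')"
        using less mono[OF x x'] by simp
      consider "x = La" "s = marked u"
        | "(x, s) \<in> tails (marked u)" "(x', s') \<in> tails (marked u)"
        | "(x, s) \<in> tails (marked u)" "s' = marked u"
        using x x' by auto
      then show "leader_rank x \<le> leader_rank x'"
      proof cases
        case 1
        then show ?thesis
          by simp
      next
        case 2
        then show ?thesis
          using noncrossingD[OF nc, of x "tau Lc s" x' "tau Lc s'"] lift less'
          by (simp flip: T_def)
      next
        case 3
        have "s \<noteq> []"
          using less by auto
        then obtain r where r: "tau Lc s = Lc # r"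
          using first by blast
        then have "(Lc, r) \<in> tails T"
          using lift[OF 3(1)] tails_Cons_tails by metis
        moreover have "lex_less follower_rank r T"
          using less' by (simp add: r 3(2) tau)
        ultimately have "leader_rank Lc \<le> leader_rank La"
          using noncrossingD[OF nc, of Lc r La T] by (simp flip: T_def)
        then show ?thesis
          by simp
      qed
    qed
  qed
qed

lemma noncrossing_sigma:
  assumes "x \<in> {Lb, Lc}" and "set u \<subseteq> {Lb, Lc}"
  shows "noncrossing (x # sigma x u) \<longleftrightarrow> noncrossing u"
proof -
  have "La \<notin> set u"
    using assms(2) by auto
  then show ?thesis
    using assms(1) noncrossing_sigma_Lb noncrossing_sigma_Lc by auto
qed

lemma noncrossing_Nil: "noncrossing []"
  by (auto simp: noncrossing_def marked_def)

lemma noncrossing_pal: "set q \<subseteq> {Lb, Lc} \<Longrightarrow> noncrossing (pal q)"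
proof (induction q)
  case (Cons x q)
  then show ?case
    using noncrossing_sigma[of x "pal q"] by (simp add: set_pal)
qed (simp add: noncrossing_Nil)

text \<open>If \<open>x # u\<close> begins with \<open>b\<close>, then \<open>bb\<close> occurs in \<open>marked (x # u)\<close>, and a \<open>c\<close> not followed by
  \<open>b\<close> would cross it. If it begins with \<open>c\<close>, then \<open>marked (x # u)\<close> begins with \<open>bc\<close> and is
  smaller than its proper suffixes, which rules out that a later \<open>b\<close> is followed by something
  smaller than \<open>c\<close>.\<close>

lemma noncrossing_Cons:
  assumes nc: "noncrossing (x # u)" and set: "set (x # u) \<subseteq> {Lb, Lc}"
  obtains u' where "u = sigma x u'"
proof (rule range_sigmaI[of u x])
  fix y s
  assume ys: "(y, s) \<in> tails u" and "y \<noteq> x"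
  have "La \<notin> set (x # u)"
    using set by auto
  have y: "y \<in> {Lb, Lc}" "set s \<subseteq> {Lb, Lc}"
    using ys set by (auto simp: tails_iff)
  have T: "(y, s @ [La]) \<in> tails (x # u @ [La])"
    using tails_append[OF ys] by simp
  show "s \<noteq> [] \<and> hd s = x"
  proof (cases "x = Lb")
    case True
    then have "y = Lc"
      using y(1) \<open>y \<noteq> x\<close> by auto
    have "\<not> lex_less follower_rank (Lb # u @ [La]) (s @ [La])"
    proof
      assume "lex_less follower_rank (Lb # u @ [La]) (s @ [La])"
      then have "leader_rank Lb \<le> leader_rank Lc"
        using noncrossingD[OF nc, of Lb "Lb # u @ [La]" Lc "s @ [La]"] T
        by (simp add: marked_def True \<open>y = Lc\<close>)
      then show False
        by simp
    qed
    then show ?thesis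
      using y(2) True by (cases s) auto
  next
    case False
    then have "x = Lc"
      using set by auto
    then have "y = Lb"
      using y(1) \<open>y \<noteq> x\<close> by auto
    obtain z where z: "(z, Lb # s @ [La]) \<in> tails (Lc # u @ [La])"
      using tails_predecessor[OF T] \<open>x = Lc\<close> \<open>y = Lb\<close> by auto
    have "z \<noteq> La"
    proof
      assume "z = La"
      then have "(La, Lb # s @ [La]) \<in> tails (marked (x # u))"
        using z \<open>x = Lc\<close> by (simp add: marked_def)
      then show False
        using tails_marked_La[OF \<open>La \<notin> set (x # u)\<close>] by blast
    qed
    have "\<not> lex_less follower_rank (Lb # s @ [La]) (Lb # Lc # u @ [La])"
    proof
      assume "lex_less follower_rank (Lb # s @ [La]) (Lb # Lc # u @ [La])"
      then have "leader_rank z \<le> leader_rank La"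
        using noncrossingD[OF nc, of z "Lb # s @ [La]" La "Lb # Lc # u @ [La]"] z
        by (simp add: marked_def \<open>x = Lc\<close>)
      then show False
        using \<open>z \<noteq> La\<close> by (cases z) auto
    qed
    then show ?thesis
      using y(2) \<open>x = Lc\<close> by (cases s) auto
  qed
qed (use that in blast)

lemma noncrossing_imp_pal:
  assumes "noncrossing u" and "set u \<subseteq> {Lb, Lc}"
  shows "\<exists>q. u = pal q"
  using assms
proof (induction u rule: length_induct)
  case (1 u)
  show ?case
  proof (cases u)
    case Nil
    then show ?thesis
      by (intro exI[of _ "[]"]) simp
  next
    case (Cons x r)
    obtain u' where u': "r = sigma x u'"
      using noncrossing_Cons[of x r] 1(2,3) Cons by auto
    have set: "x \<in> {Lb, Lc}" "set u' \<subseteq> {Lb, Lc}"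
      using 1(3) Cons u' set_sigma[of u' x] by auto
    then have "noncrossing u'"
      using 1(2) Cons u' noncrossing_sigma by simp
    moreover have "length u' < length u"
      using Cons u' length_sigma[of u' x] by simp
    ultimately obtain q where "u' = pal q"
      using 1(1) set(2) by blast
    then show ?thesis
      using Cons u' by (intro exI[of _ "x # q"]) simp
  qed
qed

section \<open>Framed words\<close>

definition frame :: "word \<Rightarrow> word" where
  "frame u = Lb # La # sigma La u @ [Lb]"

text \<open>A version of \<open>sigma La\<close> that turns the right marker into the final \<open>b\<close> of the framed word, so
  that \<open>frame u\<close> is the image of \<open>marked u\<close> as a whole.\<close>

fun theta :: "word \<Rightarrow> word" where
  "theta [] = []"
| "theta (y # w) = (if y = La then Lb # theta w else y # La # theta w)"

lemma theta_append: "theta (u @ v) = theta u @ theta v"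
  by (induction u) auto

lemma theta_marked: "La \<notin> set u \<Longrightarrow> theta (marked u) = frame u"
proof -
  assume "La \<notin> set u"
  then have "theta u = sigma La u"
    by (induction u) auto
  then show ?thesis
    by (simp add: marked_def frame_def theta_append)
qed

lemma tails_theta:
  "(z, s) \<in> tails (theta w) \<longleftrightarrow>
     (\<exists>y t. (y, t) \<in> tails w \<and>
        (y = La \<and> z = Lb \<and> s = theta t \<or>
         y \<noteq> La \<and> (z = y \<and> s = La # theta t \<or> z = La \<and> s = theta t)))"
  by (induction w) auto

lemma rank_abc [simp]:
  "rank [La, Lb, Lc] La = 0" "rank [La, Lb, Lc] Lb = 1" "rank [La, Lb, Lc] Lc = 2"
  by (simp_all add: rank_def)

lemma alphabet_order_abc: "alphabet_order [La, Lb, Lc]"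
  by (auto simp: alphabet_order_def UNIV_letter)

text \<open>The appended \<open>b\<close> is the first letter of the next turn around the circle. It is needed to
  separate the image \<open>b\<close> of the marker from the block \<open>ba\<close>.\<close>

lemma lex_less_theta:
  "ends_at_a s \<Longrightarrow> ends_at_a t \<Longrightarrow> lex_less follower_rank s t \<Longrightarrow>
     lex_less (rank [La, Lb, Lc]) (theta s @ [Lb]) (theta t @ [Lb])"
proof (induction follower_rank s t rule: lex_less.induct)
  case (1 y s z t)
  then show ?case
    by (cases y; cases z) auto
qed auto

text \<open>After an occurrence of a suffix the circular word always goes on with \<open>b\<close>, the first letter of
  the framed word.\<close>

lemma lex_less_rotation_frame:
  assumes "length s \<le> length (frame u)" and "length t \<le> length (frame u)"
    and "lex_less f (s @ [Lb]) (t @ [Lb])"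
  shows "lex_less f (rotation_from (frame u) s) (rotation_from (frame u) t)"
proof -
  have ext: "\<exists>e. rotation_from (frame u) r @ [Lb] = (r @ [Lb]) @ e" for r
    by (cases "length (frame u) - length r") (auto simp: rotation_from_def frame_def)
  obtain e e' where "rotation_from (frame u) s @ [Lb] = (s @ [Lb]) @ e"
    "rotation_from (frame u) t @ [Lb] = (t @ [Lb]) @ e'"
    using ext by meson
  then have "lex_less f (rotation_from (frame u) s @ [Lb]) (rotation_from (frame u) t @ [Lb])"
    using lex_less_append[OF assms(3)] by metis
  then show ?thesis
    using assms(1,2) by (simp add: lex_less_append_same length_rotation_from)
qed

lemma length_tails: "(x, s) \<in> tails w \<Longrightarrow> length s < length w"
  by (auto simp: tails_iff)

text \<open>Each rotation of \<open>frame u\<close> begins either at a block, and is then preceded by \<open>a\<close> or, for the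
  word \<open>frame u\<close> itself, by \<open>b\<close>; or inside a block, with the letter \<open>a\<close>, and is then preceded
  by \<open>b\<close> or \<open>c\<close>. Rotations of the second kind are smaller than those of the first kind, which
  agrees with their preceding letters. Two rotations inside blocks give the condition for leading
  letters \<open>b\<close> and \<open>c\<close>, and two rotations at blocks give the condition for the left marker.\<close>

lemma perfectly_clustering_frame:
  assumes u: "La \<notin> set u"
  shows "perfectly_clustering_for [La, Lb, Lc] (frame u) \<longleftrightarrow> noncrossing u"
proof -
  define W where "W = frame u"
  define T where "T = marked u"
  let ?less = "lex_less (rank [La, Lb, Lc])"
  let ?rot = "rotation_from W"
  have W: "W = theta T" "W = Lb # La # sigma La u @ [Lb]"
    using theta_marked[OF u] by (simp_all add: W_def T_def frame_def)
  have pc: "perfectly_clustering_for [La, Lb, Lc] W \<longleftrightarrow>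
      (\<forall>x s x' s'. (x, s) \<in> tails W \<longrightarrow> (x', s') \<in> tails W \<longrightarrow> ?less (?rot s) (?rot s') \<longrightarrow>
         rank [La, Lb, Lc] x' \<le> rank [La, Lb, Lc] x)"
    by (rule perfectly_clustering_for_iff[OF alphabet_order_abc])
  have len: "length (theta t) \<le> length W" if "(y, t) \<in> tails (La # T)" for y t
    using that by (auto simp: W(1) tails_iff theta_append)
  have len': "length (La # theta t) \<le> length W" if "(y, t) \<in> tails T" "y \<noteq> La" for y t
  proof -
    have "(y, La # theta t) \<in> tails W"
      using that by (auto simp: W(1) tails_theta)
    then show ?thesis
      using length_tails by fastforce
  qed
  have ends: "ends_at_a t" if "(y, t) \<in> tails (La # T)" "t \<noteq> []" for y t
    using ends_at_a_tails_marked[OF u] that by (simp add: T_def)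
  have La: "t = []" if "(La, t) \<in> tails T" for t
    using tails_marked_La[OF u] that by (simp add: T_def)
  have less: "?less (theta t @ [Lb]) (theta t' @ [Lb])"
    if "(y, t) \<in> tails (La # T)" "(y', t') \<in> tails (La # T)" "lex_less follower_rank t t'"
    for y t y' t'
  proof -
    have "t \<noteq> []" "t' \<noteq> []"
      using that(3) by auto
    then show ?thesis
      using ends that by (intro lex_less_theta) auto
  qed
  have rot: "?less (?rot (theta t)) (?rot (theta t'))"
    if "(y, t) \<in> tails (La # T)" "(y', t') \<in> tails (La # T)" "lex_less follower_rank t t'"
    for y t y' t'
    using that len less unfolding W_def by (intro lex_less_rotation_frame) blast+
  have rot': "?less (?rot (La # theta t)) (?rot (La # theta t'))"
    if "(y, t) \<in> tails T" "y \<noteq> La" "(y', t') \<in> tails T" "y' \<noteq> La" "lex_less follower_rank t t'"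
    for y t y' t'
  proof -
    have "?less (La # theta t @ [Lb]) (La # theta t' @ [Lb])"
      using less[of y t y' t'] that by simp
    then show ?thesis
      using len'[OF that(1,2)] len'[OF that(3,4)] unfolding W_def
      by (intro lex_less_rotation_frame) auto
  qed
  \<comment> \<open>The unrotated word occurs in \<open>tails W\<close> with the empty suffix, but has to be compared as the
    image of \<open>T\<close>.\<close>
  have rot_Nil: "?rot [] = ?rot (theta T)"
    by (simp add: rotation_from_def W(1))
  have Lb_tails: "(Lb, []) \<in> tails W"
    by (auto simp: W(2) tails_iff intro: exI[of _ "Lb # La # sigma La u"])
  show ?thesis
    unfolding W_def[symmetric]
  proof
    assume clus: "perfectly_clustering_for [La, Lb, Lc] W"
    show "noncrossing u"
      unfolding noncrossing_def T_def[symmetric]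
    proof (intro allI impI, rule ccontr)
      fix y t y' t'
      assume y: "(y, t) \<in> tails (La # T)" and y': "(y', t') \<in> tails (La # T)"
        and lt: "lex_less follower_rank t t'"
        and "\<not> leader_rank y \<le> leader_rank y'"
      then consider "y = Lb" "y' = Lc" | "y \<noteq> La" "y' = La"
        by (cases y; cases y') auto
      then show False
      proof cases
        case 1
        then have "(Lb, t) \<in> tails T" "(Lc, t') \<in> tails T"
          using y y' by auto
        moreover from this have "(Lb, La # theta t) \<in> tails W" "(Lc, La # theta t') \<in> tails W"
          by (auto simp: W(1) tails_theta)
        ultimately have "rank [La, Lb, Lc] Lc \<le> rank [La, Lb, Lc] Lb"
          using clus rot'[of Lb t Lc t'] lt unfolding pc by blast
        then show False
          by simp
      next
        case 2
        then have "(y, t) \<in> tails T"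
          using y by auto
        then have "(La, theta t) \<in> tails W"
          using 2(1) by (auto simp: W(1) tails_theta)
        moreover have "t' = T"
          using y' La[of t'] lt 2(2) by auto
        then have "?less (?rot (theta t)) (?rot [])"
          using rot[OF y y' lt] rot_Nil by simp
        ultimately have "rank [La, Lb, Lc] Lb \<le> rank [La, Lb, Lc] La"
          using clus Lb_tails unfolding pc by blast
        then show False
          by simp
      qed
    qed
  next
    assume nc: "noncrossing u"
    have reflect: "lex_less follower_rank t t'"
      if y: "(y, t) \<in> tails (La # T)" "t \<noteq> []" "(y', t') \<in> tails (La # T)" "t' \<noteq> []" "t \<noteq> t'"
        and not: "\<not> lex_less follower_rank t' t" for y t y' t'
      using lex_less_total[OF inj_follower_rank, of t t'] ends y not by blast
    show "perfectly_clustering_for [La, Lb, Lc] W"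
      unfolding pc
    proof (intro allI impI, rule ccontr)
      fix x s x' s'
      assume x: "(x, s) \<in> tails W" and x': "(x', s') \<in> tails W"
        and lt: "?less (?rot s) (?rot s')"
        and "\<not> rank [La, Lb, Lc] x' \<le> rank [La, Lb, Lc] x"
      then consider "x = Lb" "x' = Lc" | "x = La" "x' \<noteq> La"
        by (cases x; cases x') auto
      then show False
      proof cases
        case 1
        obtain t' where t': "(Lc, t') \<in> tails T" "s' = La # theta t'"
          using x' 1(2) by (auto simp: W(1) tails_theta)
        have "s \<noteq> []"
          using lt t'(2) by (auto simp: rotation_from_def W(2))
        then obtain t where t: "(Lb, t) \<in> tails T" "s = La # theta t"
          using x 1(1) La by (fastforce simp: W(1) tails_theta)
        have "t \<noteq> t'"
          using lt t(2) t'(2) by auto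
        moreover have "t \<noteq> []" "t' \<noteq> []"
          using t(1) t'(1) by (auto simp: T_def marked_def tails_iff append_eq_Cons_conv Cons_eq_append_conv)
        moreover have "\<not> lex_less follower_rank t' t"
          using rot'[of Lc t' Lb t] t t' lt lex_less_asym by auto
        ultimately have "lex_less follower_rank t t'"
          using t(1) t'(1) reflect[of Lb t Lc t'] by simp
        then have "leader_rank Lb \<le> leader_rank Lc"
          using noncrossingD[OF nc, of Lb t Lc t'] t(1) t'(1) by (simp add: T_def)
        then show False
          by simp
      next
        case 2
        obtain y t where t: "(y, t) \<in> tails T" "y \<noteq> La" "s = theta t"
          using x 2(1) by (auto simp: W(1) tails_theta)
        have "t \<noteq> []"
          using t(1,2) by (auto simp: T_def marked_def tails_iff append_eq_Cons_conv Cons_eq_append_conv)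
        then have "\<exists>z r. s = z # r \<and> z \<noteq> La"
          using t(3) by (cases t) auto
        then have "\<not> (\<exists>r. s' = La # r)"
          using lt by (auto simp: rotation_from_def)
        then have "s' = []"
          using x' 2(2) La by (fastforce simp: W(1) tails_theta)
        then have lt': "?less (?rot (theta t)) (?rot (theta T))"
          using lt rot_Nil t(3) by simp
        then have "t \<noteq> T"
          by auto
        moreover have "\<not> lex_less follower_rank T t"
          using rot[of La T y t] t(1) lt' lex_less_asym by auto
        moreover have "T \<noteq> []"
          by (simp add: T_def marked_def)
        ultimately have "lex_less follower_rank t T"
          using t(1) \<open>t \<noteq> []\<close> reflect[of y t La T] by simp
        then have "leader_rank y \<le> leader_rank La"
          using noncrossingD[OF nc, of y t La T] t(1) by (simp add: T_def)
        then show False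
          using t(2) by (cases y) auto
      qed
    qed
  qed
qed

lemma separated_frame: "separated_by La (frame u)"
proof -
  have "separated_by La ((La # sigma La u) @ [Lb])"
    unfolding successively_append_iff
    using separated_letter_sigma[of La u] by (simp flip: tau_append_letter)
  then show ?thesis
    by (simp add: frame_def)
qed

lemma Lc_in_frame:
  assumes "Lc \<in> set u"
  obtains s where "(Lc, La # s) \<in> tails (frame u)"
proof -
  have "Lc \<in> set (frame u)"
    using assms set_sigma[of u La] by (auto simp: frame_def)
  then obtain p s where "frame u = p @ Lc # s"
    by (meson split_list)
  then have s: "(Lc, s) \<in> tails (frame u)"
    by (auto simp: tails_iff)
  have "last (frame u) = Lb"
    by (simp add: frame_def)
  then have "s \<noteq> [] \<and> hd s = La"
    using separated_tails[OF separated_frame s] by auto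
  then show ?thesis
    using that s by (cases s) auto
qed

text \<open>Both ends are \<open>b\<close>, so only \<open>b\<close> could separate the word, but it contains \<open>ca\<close>.\<close>

lemma frame_not_in_ar_range:
  assumes "Lc \<in> set u"
  shows "\<not> in_ar_range (frame u)"
proof
  assume "in_ar_range (frame u)"
  then have "separated_by Lb (frame u)"
    using in_ar_range_separated[of "frame u"] by (auto simp: frame_def)
  moreover obtain s where "(Lc, La # s) \<in> tails (frame u)"
    using assms by (rule Lc_in_frame)
  ultimately show False
    using separated_tails by fastforce
qed

lemma rev_frame: "rev u = u \<Longrightarrow> rev (frame u) = frame u"
proof -
  assume "rev u = u"
  then have "rev (frame u) = Lb # (tau La u @ [La]) @ [Lb]"
    by (simp add: frame_def rev_sigma)
  then show ?thesis
    by (simp only: tau_append_letter) (simp add: frame_def)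
qed

text \<open>A proper power would contain \<open>bb\<close> where two copies of the root meet, against separation by
  \<open>a\<close>.\<close>

lemma primitive_frame: "primitive (frame u)"
  unfolding primitive_def
proof (intro notI, elim exE conjE)
  fix v n
  assume "v \<noteq> frame u" and w: "frame u = concat (replicate n v)"
  have "n \<noteq> 0"
    using w by (intro notI) (simp add: frame_def)
  moreover have "n \<noteq> 1"
    using w \<open>v \<noteq> frame u\<close> by (intro notI) simp
  ultimately obtain m where "n = Suc (Suc m)"
    by (metis One_nat_def not0_implies_Suc)
  then have front: "frame u = v @ v @ concat (replicate m v)"
    using w by simp
  have "frame u = concat (replicate (Suc m) v) @ v"
    using w \<open>n = Suc (Suc m)\<close> replicate_append_same[of "Suc m" v]
    by (metis concat.simps concat_append append_Nil2 replicate_Suc)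
  moreover have "v \<noteq> []"
    using front by (auto simp: frame_def)
  ultimately have "last v = last (frame u)" "hd v = hd (frame u)"
    using front by simp_all
  then have v: "last v = Lb" "hd v = Lb"
    by (simp_all add: frame_def)
  have "v = butlast v @ [Lb]"
    using \<open>v \<noteq> []\<close> v(1) append_butlast_last_id by metis
  then have "frame u = butlast v @ Lb # v @ concat (replicate m v)"
    using front by (metis append.assoc append_Cons append_Nil)
  then have "(Lb, v @ concat (replicate m v)) \<in> tails (frame u)"
    by (auto simp: tails_iff)
  then show False
    using separated_tails[OF separated_frame] v(2) \<open>v \<noteq> []\<close> by fastforce
qed

section \<open>Arnoux-Rauzy words\<close>

lemma foldr_sigma_append: "foldr sigma p (u @ v) = foldr sigma p u @ foldr sigma p v"
  by (induction p) auto

lemma ar_block_foldr: "ar_block x k y = foldr sigma (map x [0..<k]) [y]"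
  by (induction k arbitrary: y) (simp_all flip: foldr_sigma_append)

text \<open>A finite sequence of rules extends to one in which each letter recurs, so the conditions on the
  infinite sequence do not restrict the factors.\<close>

lemma ar_word_iff: "ar_word w \<longleftrightarrow> (\<exists>p y. sublist w (foldr sigma p [y]))"
proof
  assume "ar_word w"
  then show "\<exists>p y. sublist w (foldr sigma p [y])"
    by (auto simp: ar_word_def ar_language_def ar_block_foldr)
next
  assume "\<exists>p y. sublist w (foldr sigma p [y])"
  then obtain p y where w: "sublist w (foldr sigma p [y])"
    by blast
  \<comment> \<open>After \<open>p\<close>, the three rules are repeated periodically.\<close>
  define x where "x k = (if k < length p then p ! k else [La, Lb, Lc] ! (k mod 3))" for k
  have "map x [0..<length p] = p"
    by (rule nth_equalityI) (auto simp: x_def)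
  then have "sublist w (ar_block x (length p) y)"
    using w by (simp only: ar_block_foldr)
  then have "w \<in> ar_language x"
    unfolding ar_language_def by blast
  moreover have "ar_rules x"
    unfolding ar_rules_def
  proof
    fix l
    have "l \<in> {La, Lb, Lc}"
      by (cases l) auto
    then obtain i where i: "i < 3" "[La, Lb, Lc] ! i = l"
      by (metis (no_types, lifting) One_nat_def insertE less_numeral_extra(3) nth_Cons_0
          nth_Cons_Suc numeral_3_eq_3 singletonD zero_less_Suc lessI less_SucI)
    show "infinite {k. x k = l}"
      unfolding infinite_nat_iff_unbounded
    proof
      fix m
      have "(3 * (m + length p + 1) + i) mod 3 = i"
        using i(1) by (simp only: mod_mult_self4 mod_less)
      then have "x (3 * (m + length p + 1) + i) = l"
        using i(2) by (simp add: x_def)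
      then show "\<exists>n>m. n \<in> {k. x k = l}"
        by (intro exI[of _ "3 * (m + length p + 1) + i"]) auto
    qed
  qed
  ultimately show "ar_word w"
    by (auto simp: ar_word_def)
qed

lemma ar_word_sublist: "ar_word w \<Longrightarrow> sublist u w \<Longrightarrow> ar_word u"
  using sublist_order.order_trans by (fastforce simp: ar_word_iff)

lemma ar_word_sigma:
  assumes "ar_word w"
  shows "ar_word (sigma x w)"
proof -
  obtain p y where "sublist w (foldr sigma p [y])"
    using assms by (auto simp: ar_word_iff)
  then have "sublist (sigma x w) (foldr sigma (x # p) [y])"
    by (auto simp: sublist_def) blast
  then show ?thesis
    using ar_word_iff by blast
qed

lemma sigma_not_Nil: "w \<noteq> [] \<Longrightarrow> sigma x w \<noteq> []"
  by (cases w) auto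

text \<open>Applying one more rule to another letter \<open>y'\<close> puts a nonempty word in front of the block of
  \<open>y\<close>.\<close>

lemma ar_word_extend_left:
  assumes "ar_word w"
  obtains z where "ar_word (z # w)"
proof -
  obtain p y where "sublist w (foldr sigma p [y])"
    using assms by (auto simp: ar_word_iff)
  then obtain u v where w: "foldr sigma p [y] = u @ w @ v"
    by (auto simp: sublist_def)
  obtain y' where y': "y' \<noteq> y"
    by (metis letter.distinct(1))
  have "foldr sigma p [y'] \<noteq> []"
    by (induction p) (auto simp: sigma_not_Nil)
  then obtain u' z where z: "foldr sigma p [y'] @ u = u' @ [z]"
    by (metis append_is_Nil_conv rev_exhaust)
  have "foldr sigma (p @ [y]) [y'] = u' @ (z # w) @ v"
    using y' z w foldr_sigma_append[of p "[y']" "[y]"] by simp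
  then have "sublist (z # w) (foldr sigma (p @ [y]) [y'])"
    by (auto simp: sublist_def)
  then show ?thesis
    using that ar_word_iff by blast
qed

text \<open>For \<open>x \<noteq> b\<close>, the word \<open>b pal(x q) b\<close> is a prefix of the image of \<open>b pal(q) b\<close> under
  \<open>sigma x\<close>. For \<open>x = b\<close> that image starts with one \<open>b\<close> less, which a letter to the left of
  \<open>b pal(q) b\<close> supplies.\<close>

lemma ar_word_pal: "ar_word (Lb # pal q @ [Lb])"
proof (induction q)
  case Nil
  have "sublist [Lb, Lb] (foldr sigma [Lb, Lb] [Lc])"
    by (auto simp: sublist_def intro: exI[of _ "[Lc]"])
  then have "ar_word [Lb, Lb]"
    unfolding ar_word_iff by blast
  then show ?case
    by simp
next
  case (Cons x q)
  show ?case
  proof (cases "x = Lb")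
    case True
    obtain z where "ar_word (z # Lb # pal q @ [Lb])"
      using Cons by (rule ar_word_extend_left)
    then have "ar_word (sigma Lb (z # Lb # pal q @ [Lb]))"
      by (rule ar_word_sigma)
    moreover have "sublist (Lb # pal (x # q) @ [Lb]) (sigma Lb (z # Lb # pal q @ [Lb]))"
      by (cases "z = Lb") (auto simp: True sublist_Cons_right)
    ultimately show ?thesis
      by (rule ar_word_sublist)
  next
    case False
    have "ar_word (sigma x (Lb # pal q @ [Lb]))"
      using Cons by (rule ar_word_sigma)
    moreover have "sigma x (Lb # pal q @ [Lb]) = (Lb # pal (x # q) @ [Lb]) @ [x]"
      using False by simp
    ultimately show ?thesis
      by (metis ar_word_sublist sublist_append_rightI)
  qed
qed

lemma ar_word_frame:
  assumes "ar_word (Lb # u @ [Lb])"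
  shows "ar_word (frame u)"
proof -
  have "sigma La (Lb # u @ [Lb]) = frame u @ [La]"
    by (simp add: frame_def)
  then show ?thesis
    using ar_word_sigma[OF assms, of La] ar_word_sublist by (metis sublist_append_rightI)
qed

lemma ar_word_map:
  assumes "inj p" and "ar_word w"
  shows "ar_word (map p w)"
proof -
  have fold: "foldr sigma (map p ps) (map p u) = map p (foldr sigma ps u)" for ps u
    by (induction ps) (simp_all add: sigma_map[OF assms(1)])
  obtain ps y where "sublist w (foldr sigma ps [y])"
    using assms(2) by (auto simp: ar_word_iff)
  then have "sublist (map p w) (foldr sigma (map p ps) (map p [y]))"
    unfolding fold by (rule map_mono_sublist)
  then show ?thesis
    unfolding ar_word_iff by auto
qed

lemma ar_word_separated:
  assumes "ar_word w"
  obtains x where "separated_by x w"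
proof -
  obtain p y where w: "sublist w (foldr sigma p [y])"
    using assms by (auto simp: ar_word_iff)
  have "\<exists>x. separated_by x (foldr sigma p [y])"
  proof (cases p)
    case (Cons x p')
    then show ?thesis
      using separated_letter_sigma[of x "foldr sigma p' [y]"]
      by (auto simp: successively_Cons)
  qed simp
  then show ?thesis
    using that w by (auto simp: sublist_def successively_append_iff)
qed

section \<open>The words built from a directive word\<close>

text \<open>Each letter of \<open>u\<close> is preceded by \<open>a\<close> in \<open>a sigma_a(u)\<close>. A letter \<open>a\<close> of \<open>u\<close> thus
  produces a pair \<open>aa\<close>, which becomes \<open>aba\<close>, just as if the letter had been \<open>b\<close>; the letters
  \<open>c\<close> are unaffected.\<close>

lemma insert_b_sigma:
  "set u \<subseteq> {La, Lc} \<Longrightarrow>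
     insert_b (La # sigma La u @ [Lb]) = La # sigma La (map (transpose La Lb) u) @ [Lb]"
  by (induction u) auto

lemma built_from_La:
  assumes "set v \<subseteq> {La, Lc}"
  shows "built_from (La # v) w \<longleftrightarrow> w = frame (pal (map (transpose La Lb) v))"
proof -
  have "Lb \<notin> set (La # v)"
    using assms by auto
  then have "tau_word (La # v) [Lb] = La # sigma La (pal v) @ [Lb]"
    using tau_word_new_letter by fastforce
  then show ?thesis
    using assms
    by (simp add: built_from_def frame_def insert_b_sigma set_pal pal_map inj_transpose
        del: tau_word_simps)
qed

lemma insert_b_map: "insert_b (map (transpose La Lc) u) = map (transpose La Lc) (insert_b u)"
proof (induction u rule: insert_b.induct)
  case (1 x y u)
  then show ?case
    by (cases x; cases y) auto
qed auto

lemma built_from_map: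
  assumes "built_from v w"
  shows "built_from (map (transpose La Lc) v) (map (transpose La Lc) w)"
proof -
  have "tau_word (map (transpose La Lc) v) (map (transpose La Lc) u) =
      map (transpose La Lc) (tau_word v u)" for u
    by (induction v) (simp_all add: tau_map)
  from this[of "[Lb]"] show ?thesis
    using assms by (simp add: built_from_def insert_b_map)
qed

lemma built_from_La_properties:
  assumes v: "set v = {La, Lc}" and w: "built_from v w" and La: "hd v = La"
  shows "ar_word w \<and> perfectly_clustering_for [La, Lb, Lc] w \<and> \<not> in_ar_range w"
proof -
  obtain v' where v': "v = La # v'"
    using v La by (cases v) auto
  define q where "q = map (transpose La Lb) v'"
  have "set v' \<subseteq> {La, Lc}" "Lc \<in> set v'"
    using v by (auto simp: v')
  then have q: "set q \<subseteq> {Lb, Lc}" "Lc \<in> set q"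
    by (force simp: q_def)+
  have "w = frame (pal q)"
    using w built_from_La[OF \<open>set v' \<subseteq> {La, Lc}\<close>] by (simp add: v' q_def)
  moreover have "La \<notin> set (pal q)"
    using q(1) by (auto simp: set_pal)
  ultimately show ?thesis
    using q by (simp add: ar_word_frame ar_word_pal perfectly_clustering_frame noncrossing_pal
        frame_not_in_ar_range set_pal)
qed

lemma built_from_properties:
  assumes v: "set v = {La, Lc}" and w: "built_from v w"
  shows "ar_word w \<and> perfectly_clustering_for [La, Lb, Lc] w \<and> \<not> in_ar_range w"
proof (cases "hd v = La")
  case True
  then show ?thesis
    using built_from_La_properties assms by blast
next
  case False
  let ?p = "transpose La Lc"
  have "v \<noteq> []"
    using v by force
  then have "hd v \<in> {La, Lc}"
    unfolding v[symmetric] by (rule hd_in_set)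
  then have "hd v = Lc"
    using False by simp
  have "set (map ?p v) = {La, Lc}"
    unfolding set_map v by auto
  moreover have "hd (map ?p v) = La"
    using \<open>v \<noteq> []\<close> \<open>hd v = Lc\<close> by (simp add: hd_map)
  ultimately have good: "ar_word (map ?p w)" "perfectly_clustering_for [La, Lb, Lc] (map ?p w)"
    "\<not> in_ar_range (map ?p w)"
    using built_from_La_properties[of "map ?p v" "map ?p w"] built_from_map[OF w] by simp_all
  have twice: "map ?p (map ?p w) = w"
    by simp
  have "ar_word w"
    using ar_word_map[OF inj_transpose good(1)] twice by metis
  moreover have "perfectly_clustering_for [Lc, Lb, La] w"
    using perfectly_clustering_for_map[OF bij_transpose alphabet_order_abc good(2), of La Lc] twice
    by simp
  then have "perfectly_clustering_for [La, Lb, Lc] w"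
    using perfectly_clustering_for_rev[of "[Lc, Lb, La]" w] alphabet_order_rev[OF alphabet_order_abc]
    by simp
  moreover have "\<not> in_ar_range w"
    using good(3) in_ar_range_map[of ?p "map ?p w"] twice by (metis bij_transpose)
  ultimately show ?thesis
    by simp
qed

section \<open>Clustering words outside the ranges\<close>

text \<open>If the end letters \<open>y\<close> and \<open>z\<close> differed, the circular word would contain \<open>ys\<close>, \<open>sz\<close> and
  \<open>zy\<close>, and each of the six orders of these three letters violates the order condition for two of
  these factors.\<close>

lemma clustering_ends_equal:
  assumes ord: "alphabet_order ord" "perfectly_clustering_for ord w"
    and sep: "separated_by s w" and w: "w \<noteq> []" "hd w \<noteq> s" "last w \<noteq> s"
  shows "hd w = last w"
proof (rule ccontr)
  define y z where "y = hd w" and "z = last w"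
  assume "hd w \<noteq> last w"
  then have ne: "y \<noteq> z" "y \<noteq> s" "z \<noteq> s"
    using w by (simp_all add: y_def z_def)
  obtain r where r: "w = y # r"
    using w(1) by (cases w) (auto simp: y_def)
  have "r \<noteq> []"
    using \<open>hd w \<noteq> last w\<close> r by auto
  then have ys: "(y, r) \<in> tails w" "hd (r @ w) = s"
    using separated_tails[OF sep, of y r] ne r by auto
  obtain t where t: "w = t @ [z]"
    using w(1) append_butlast_last_id z_def by metis
  have "t \<noteq> []"
    using t r ne by auto
  then obtain t' x where t': "t = t' @ [x]"
    by (cases t rule: rev_cases) auto
  have "x = s"
    using sep ne by (auto simp: t t' successively_append_iff)
  then have sz: "(s, [z]) \<in> tails w" "hd ([z] @ w) = z"
    by (auto simp: t t' tails_iff)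
  have zy: "(z, []) \<in> tails w" "hd ([] @ w) = y"
    by (auto simp: t tails_iff y_def)
  note adj = clustering_adjacent[OF ord]
  let ?r = "rank ord"
  have "?r y \<noteq> ?r z" "?r y \<noteq> ?r s" "?r z \<noteq> ?r s"
    using ne inj_rank[OF ord(1)] by (auto simp: inj_eq)
  moreover have "?r s < ?r y \<longrightarrow> ?r z \<le> ?r y" "?r y < ?r s \<longrightarrow> ?r y \<le> ?r z"
    using adj[OF ys(1) zy(1)] adj[OF zy(1) ys(1)] ys(2) zy(2) by auto
  moreover have "?r s < ?r z \<longrightarrow> ?r s \<le> ?r y" "?r z < ?r s \<longrightarrow> ?r y \<le> ?r s"
    using adj[OF ys(1) sz(1)] adj[OF sz(1) ys(1)] ys(2) sz(2) by auto
  moreover have "?r y < ?r z \<longrightarrow> ?r s \<le> ?r z" "?r z < ?r y \<longrightarrow> ?r z \<le> ?r s"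
    using adj[OF zy(1) sz(1)] adj[OF sz(1) zy(1)] zy(2) sz(2) by auto
  ultimately show False
    by linarith
qed

text \<open>The square of the common end letter occurs circularly, and two squares of different letters cross
  in each order.\<close>

lemma clustering_no_square:
  assumes ord: "alphabet_order ord" "perfectly_clustering_for ord w"
    and w: "w \<noteq> []" "hd w = last w" and x: "x \<noteq> hd w"
  shows "(x, x # s) \<notin> tails w"
proof
  assume xx: "(x, x # s) \<in> tails w"
  have "w = butlast w @ [hd w]"
    using w by simp
  then have yy: "(hd w, []) \<in> tails w"
    unfolding tails_iff by blast
  have "rank ord x \<noteq> rank ord (hd w)"
    using x inj_rank[OF ord(1)] by (auto simp: inj_eq)
  then consider "rank ord x < rank ord (hd w)" | "rank ord (hd w) < rank ord x"
    by linarith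
  then show False
    using clustering_adjacent[OF ord xx yy] clustering_adjacent[OF ord yy xx] by cases auto
qed

lemma separated_decomposition:
  assumes "separated_by La w" and "\<And>s. (La, La # s) \<notin> tails w"
    and "w \<noteq> []" and "hd w \<noteq> La" and "last w = Lb"
  shows "\<exists>u. La \<notin> set u \<and> w = sigma La u @ [Lb]"
  using assms
proof (induction w rule: induct_list012)
  case (2 x)
  then show ?case
    by (intro exI[of _ "[]"]) simp
next
  case (3 y z r)
  have "z = La"
    using 3(3,6) by simp
  then have "r \<noteq> []"
    using 3(7) by auto
  have "hd r \<noteq> La"
    using 3(4)[of "tl r"] \<open>z = La\<close> \<open>r \<noteq> []\<close> by (cases r) auto
  then obtain u where "La \<notin> set u" "r = sigma La u @ [Lb]"
    using 3(1) 3(3-7) \<open>r \<noteq> []\<close> by (auto simp: successively_Cons)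
  then show ?case
    using \<open>z = La\<close> 3(6) by (intro exI[of _ "y # u"]) auto
qed simp

text \<open>The word alternates between \<open>a\<close> and letters of \<open>{b, c}\<close>. It must contain \<open>c\<close>, because
  otherwise \<open>b\<close> would separate it too and it would be in the range of the morphisms for \<open>b\<close>.\<close>

lemma clustering_is_frame:
  assumes ord: "alphabet_order ord" "perfectly_clustering_for ord w"
    and w: "separated_by La w" "w \<noteq> []" "hd w = Lb" and range: "\<not> in_ar_range w"
  shows "\<exists>u. w = frame u \<and> set u \<subseteq> {Lb, Lc} \<and> Lc \<in> set u"
proof -
  have "last w \<noteq> La"
    using separated_in_ar_range[OF w(1)] range by blast
  then have last: "last w = Lb"
    using clustering_ends_equal[OF ord w(1,2)] w(3) by simp
  have no_aa: "(La, La # s) \<notin> tails w" for s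
    using clustering_no_square[OF ord w(2)] w(3) last by simp
  obtain u where u: "La \<notin> set u" "w = sigma La u @ [Lb]"
    using separated_decomposition[OF w(1) no_aa w(2)] w(3) last by auto
  have "Lc \<in> set u"
  proof (rule ccontr)
    assume "Lc \<notin> set u"
    then have "set u \<subseteq> {Lb}"
      using u(1) by (metis letter.exhaust singletonI subsetI)
    moreover have "hd (sigma La r @ [Lb]) = Lb" if "set r \<subseteq> {Lb}" for r
      using that by (cases r) auto
    ultimately have "separated_by Lb (sigma La u @ [Lb])"
      by (induction u) (auto simp: successively_Cons)
    then have "in_ar_range w"
      using separated_in_ar_range[of Lb w] last u(2) by simp
    then show False
      using range by simp
  qed
  then obtain y u' where u': "u = y # u'"
    by (cases u) auto
  then have "y = Lb"
    using w(3) u by auto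
  then have "w = frame u'"
    using u(2) u' by (simp add: frame_def)
  moreover have "x \<in> {Lb, Lc}" if "x \<in> set u'" for x
  proof -
    have "x \<noteq> La"
      using that u(1) u' by auto
    then show ?thesis
      by (cases x) auto
  qed
  moreover have "Lc \<in> set u'"
    using u' \<open>Lc \<in> set u\<close> \<open>y = Lb\<close> by auto
  ultimately show ?thesis
    by blast
qed

text \<open>The circular factors \<open>bb\<close> and \<open>ca\<close> satisfy the order condition only if \<open>b\<close> lies between
  \<open>a\<close> and \<open>c\<close>.\<close>

lemma frame_middle_letter:
  assumes ord: "alphabet_order ord" "perfectly_clustering_for ord (frame u)" and u: "Lc \<in> set u"
  shows "ord ! 1 = Lb"
proof -
  obtain s where ca: "(Lc, La # s) \<in> tails (frame u)"
    using u by (rule Lc_in_frame)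
  have bb: "(Lb, []) \<in> tails (frame u)"
    by (auto simp: frame_def tails_iff intro: exI[of _ "Lb # La # sigma La u"])
  have hd: "hd (frame u) = Lb"
    by (simp add: frame_def)
  have imp: "rank ord Lb < rank ord La \<longrightarrow> rank ord Lc \<le> rank ord Lb"
    "rank ord La < rank ord Lb \<longrightarrow> rank ord Lb \<le> rank ord Lc"
    using clustering_adjacent[OF ord bb ca] clustering_adjacent[OF ord ca bb] hd by auto
  obtain x y z where xyz: "ord = [x, y, z]" "x \<noteq> y" "x \<noteq> z" "y \<noteq> z"
    using ord(1) by (rule alphabet_order_cases)
  then show ?thesis
    using imp by (cases x; cases y; cases z) (auto simp: rank_def)
qed

lemma frame_clustering_abc:
  assumes ord: "alphabet_order ord" "perfectly_clustering_for ord (frame u)" and u: "Lc \<in> set u"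
  shows "perfectly_clustering_for [La, Lb, Lc] (frame u)"
proof -
  obtain x y z where xyz: "ord = [x, y, z]" "x \<noteq> y" "x \<noteq> z" "y \<noteq> z"
    using ord(1) by (rule alphabet_order_cases)
  have "y = Lb"
    using frame_middle_letter[OF assms] xyz(1) by simp
  then have "ord = [La, Lb, Lc] \<or> ord = [Lc, Lb, La]"
    using xyz by (cases x; cases z) auto
  then show ?thesis
    using ord(2) perfectly_clustering_for_rev[OF ord] by auto
qed

lemma clustering_frame_built_from:
  assumes "perfectly_clustering_for [La, Lb, Lc] (frame u)"
    and u: "set u \<subseteq> {Lb, Lc}" "Lc \<in> set u"
  shows "rev u = u" and "\<exists>v. set v = {La, Lc} \<and> built_from v (frame u)"
proof -
  have "La \<notin> set u"
    using u(1) by auto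
  then have "noncrossing u"
    using assms(1) by (simp add: perfectly_clustering_frame)
  then obtain q where q: "u = pal q"
    using noncrossing_imp_pal u(1) by blast
  then show "rev u = u"
    by (simp add: rev_pal)
  define v where "v = map (transpose La Lb) q"
  have set_q: "set q \<subseteq> {Lb, Lc}" "Lc \<in> set q"
    using u by (simp_all add: q set_pal)
  then have "set v \<subseteq> {La, Lc}" "Lc \<in> set v"
    by (force simp: v_def)+
  moreover have "map (transpose La Lb) v = q"
    by (simp add: v_def)
  ultimately have "set (La # v) = {La, Lc} \<and> built_from (La # v) (frame u)"
    using q built_from_La[of v "frame u"] by auto
  then show "\<exists>v. set v = {La, Lc} \<and> built_from v (frame u)"
    by blast
qed

lemma sublist_square_tails: "sublist [x, x] w \<Longrightarrow> \<exists>s. (x, x # s) \<in> tails w"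
  by (auto simp: sublist_def tails_iff)

lemma tau_no_square:
  "x \<noteq> y \<Longrightarrow> \<not> sublist [y, y] (tau x w)"
proof
  assume "x \<noteq> y" "sublist [y, y] (tau x w)"
  then obtain s where "(y, y # s) \<in> tails (tau x w)"
    using sublist_square_tails by blast
  then have "(y, y # s @ [x]) \<in> tails (x # sigma x w)"
    using tails_append[of y "y # s" "tau x w" "[x]"] by (simp add: tau_append_letter)
  then show False
    using separated_tails[OF separated_letter_sigma] \<open>x \<noteq> y\<close> by fastforce
qed

theorem proposition17:
  shows "(\<forall>w. ar_word w \<and> perfectly_clustering w \<and> \<not> in_ar_range w \<longrightarrow>
            (\<exists>p w1. bij p \<and> w1 = map p w \<and>
               (\<exists>v. set v = {La, Lc} \<and> built_from v w1) \<and>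
               palindrome w1 \<and> w1 \<noteq> [] \<and> hd w1 = Lb \<and> last w1 = Lb \<and>
               La \<in> set w1 \<and> Lc \<in> set w1 \<and>
               \<not> sublist [La, La] w1 \<and> \<not> sublist [Lc, Lc] w1 \<and>
               primitive w1 \<and>
               (\<forall>ord. alphabet_order ord \<and> perfectly_clustering_for ord w1 \<longrightarrow> ord ! 1 = Lb)))
       \<and> (\<forall>v. set v = {La, Lc} \<longrightarrow>
            \<not> (sublist [La, La] (tau_word v [Lb]) \<and> sublist [Lc, Lc] (tau_word v [Lb])))
       \<and> (\<forall>v w. set v = {La, Lc} \<longrightarrow>
            (built_from v w \<longleftrightarrow> (\<exists>w'. b_conjugate w w' \<and> conj_built_from v w')))
       \<and> (\<forall>v w. set v = {La, Lc} \<and> built_from v w \<longrightarrow>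
            ar_word w \<and> perfectly_clustering_for [La, Lb, Lc] w \<and> \<not> in_ar_range w)"
proof (intro conjI allI impI)
  fix w
  assume "ar_word w \<and> perfectly_clustering w \<and> \<not> in_ar_range w"
  then obtain ord where ar: "ar_word w" and ord: "alphabet_order ord" "perfectly_clustering_for ord w"
    and range: "\<not> in_ar_range w"
    by (auto simp: perfectly_clustering_def)
  obtain s where sep: "separated_by s w"
    using ar by (rule ar_word_separated)
  have w: "w \<noteq> []" "hd w \<noteq> s"
    using separated_in_ar_range[OF sep] range by auto
  \<comment> \<open>A renaming that sends the separating letter to \<open>a\<close> and the end letter to \<open>b\<close>.\<close>
  define p where "p = transpose (transpose s La (hd w)) Lb \<circ> transpose s La"
  have "bij p"
    by (simp add: p_def bij_comp)
  have ps: "p s = La" and ph: "p (hd w) = Lb"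
    using w(2) by (auto simp: p_def transpose_def)
  define w1 where "w1 = map p w"
  have ord1: "alphabet_order (map p ord)" "perfectly_clustering_for (map p ord) w1"
    using alphabet_order_map[OF \<open>bij p\<close> ord(1)] perfectly_clustering_for_map[OF \<open>bij p\<close> ord]
    by (simp_all add: w1_def)
  have sep1: "separated_by La w1"
    unfolding w1_def successively_map using sep by (rule successively_mono) (auto simp: ps)
  have w1: "w1 \<noteq> []" "hd w1 = Lb"
    using w(1) ph by (simp_all add: w1_def hd_map)
  have "\<not> in_ar_range w1"
    using range in_ar_range_map[OF \<open>bij p\<close>] by (auto simp: w1_def)
  then obtain u where u: "w1 = frame u" "set u \<subseteq> {Lb, Lc}" "Lc \<in> set u"
    using clustering_is_frame[OF ord1 sep1 w1] by blast
  have clus: "perfectly_clustering_for [La, Lb, Lc] (frame u)"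
    using frame_clustering_abc ord1 u by simp
  note built = clustering_frame_built_from[OF clus u(2,3)]
  have last1: "last w1 = Lb"
    by (simp add: u(1) frame_def)
  have square: "\<not> sublist [x, x] w1" if "x \<noteq> Lb" for x
    using clustering_no_square[OF ord1 w1(1), of x] sublist_square_tails[of x w1] w1(2) last1 that
    by auto
  have "Lc \<in> set w1"
    using u(3) set_sigma[of u La] by (auto simp: u(1) frame_def)
  moreover have "La \<in> set w1"
    by (simp add: u(1) frame_def)
  moreover have "palindrome w1"
    using rev_frame[OF built(1)] by (simp add: palindrome_def u(1))
  moreover have "primitive w1"
    by (simp add: u(1) primitive_frame)
  moreover have "\<forall>ord. alphabet_order ord \<and> perfectly_clustering_for ord w1 \<longrightarrow> ord ! 1 = Lb"
    using frame_middle_letter u by blast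
  ultimately show "\<exists>p w1. bij p \<and> w1 = map p w \<and>
               (\<exists>v. set v = {La, Lc} \<and> built_from v w1) \<and>
               palindrome w1 \<and> w1 \<noteq> [] \<and> hd w1 = Lb \<and> last w1 = Lb \<and>
               La \<in> set w1 \<and> Lc \<in> set w1 \<and>
               \<not> sublist [La, La] w1 \<and> \<not> sublist [Lc, Lc] w1 \<and>
               primitive w1 \<and>
               (\<forall>ord. alphabet_order ord \<and> perfectly_clustering_for ord w1 \<longrightarrow> ord ! 1 = Lb)"
    using \<open>bij p\<close> w1_def w1 last1 built(2) u(1) square by (intro exI[of _ p] exI[of _ w1]) auto
next
  fix v :: word
  assume "set v = {La, Lc}"
  then obtain x v' where v: "v = x # v'"
    by (cases v) auto
  obtain y where "y \<in> {La, Lc}" "y \<noteq> x"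
    by (cases x) auto
  then show "\<not> (sublist [La, La] (tau_word v [Lb]) \<and> sublist [Lc, Lc] (tau_word v [Lb]))"
    using tau_no_square[of x y "tau_word v' [Lb]"] v by auto
next
  fix v w
  show "built_from v w \<longleftrightarrow> (\<exists>w'. b_conjugate w w' \<and> conj_built_from v w')"
    by (auto simp: built_from_def b_conjugate_def conj_built_from_def)
next
  fix v w
  assume "set v = {La, Lc} \<and> built_from v w"
  then have "ar_word w \<and> perfectly_clustering_for [La, Lb, Lc] w \<and> \<not> in_ar_range w"
    using built_from_properties by blast
  then show "ar_word w" "perfectly_clustering_for [La, Lb, Lc] w" "\<not> in_ar_range w"
    by blast+
qed

end
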